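(* If $f\in\omega^\omega$ is $3$-generic then there is no set $X\subseteq\omega$ such that $f\equiv_{NED} X$.
   Context: Sets are identified with characteristic functions, so $2^\omega\subseteq\omega^\omega$. A function $f\in\omega^\omega$ is $3$-generic if it is $3$-generic for Cohen forcing with $\omega^{<\omega}$: for every $\Sigma^0_3$ set $W\subseteq\omega^{<\omega}$ some initial segment of $f$ is in $W$ or has no extension in $W$ (equivalently, every $\Sigma^0_3(f)$ sentence or its negation is forced by an initial segment of $f$). A set $S\subseteq\omega$ has density $0$ iff $\lim_{l\to\infty}|S\cap\{0,\dots,l-1\}|/l=0$. $\Box$ is a special symbol not in $\omega$ (functions into $\omega\cup\{\Box\}$ are coded as elements of $\omega^\omega$ by shifting values by one and letting $0$ code $\Box$). For $f:\omega\to\omega$, an effective dense description of $f$ is a function $h:\omega\to\omega\cup\{\Box\}$ such that for all $x$ either $h(x)=f(x)$ or $h(x)=\Box$, and $\{x:h(x)=\Box\}$ has density $0$. $f\ge_{NED} g$ (non-uniform effective dense reducibility) means every effective dense description of $f$ (Turing) computes an effective dense description of $g$; $f\equiv_{NED} g$ means $f\ge_{NED} g$ and $g\ge_{NED} f$. *)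

theory Defs
  imports
    Complex_Main
    "HOL-Library.Nat_Bijection"
    "HOL-Library.Sublist"
    "HOL-Library.Indicator_Function"
begin

subsection \<open>Relative computability\<close>

text \<open>
  Partial functions on the natural numbers are unary; several arguments are passed through the
  pairing bijection \<^const>\<open>prod_encode\<close>. \<open>prec_pfun f g\<close> is primitive recursion with
  a parameter, and \<open>mu_pfun f a\<close> is the least \<open>n\<close> with \<open>f \<langle>a, n\<rangle> = 0\<close>, which requires
  \<open>f \<langle>a, m\<rangle>\<close> to be defined for all \<open>m < n\<close>.
\<close>

primrec prec_pfun :: "(nat \<rightharpoonup> nat) \<Rightarrow> (nat \<rightharpoonup> nat) \<Rightarrow> nat \<Rightarrow> nat \<Rightarrow> nat option" where
  "prec_pfun f g a 0 = f a"
| "prec_pfun f g a (Suc n) =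
     Option.bind (prec_pfun f g a n) (\<lambda>i. g (prod_encode (a, prod_encode (n, i))))"

definition mu_pfun :: "(nat \<rightharpoonup> nat) \<Rightarrow> nat \<rightharpoonup> nat" where
  "mu_pfun f a =
     (if \<exists>n. f (prod_encode (a, n)) = Some 0 \<and> (\<forall>m<n. \<exists>k. f (prod_encode (a, m)) = Some (Suc k))
      then Some (LEAST n. f (prod_encode (a, n)) = Some 0)
      else None)"

inductive partial_recursive_in :: "(nat \<Rightarrow> nat) \<Rightarrow> (nat \<rightharpoonup> nat) \<Rightarrow> bool" for orc :: "nat \<Rightarrow> nat" where
  zero: "partial_recursive_in orc (\<lambda>x. Some 0)"
| succ: "partial_recursive_in orc (\<lambda>x. Some (Suc x))"
| left: "partial_recursive_in orc (\<lambda>x. Some (fst (prod_decode x)))"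
| right: "partial_recursive_in orc (\<lambda>x. Some (snd (prod_decode x)))"
| oracle_query: "partial_recursive_in orc (\<lambda>x. Some (orc x))"
| pair: "partial_recursive_in orc f \<Longrightarrow> partial_recursive_in orc g \<Longrightarrow>
    partial_recursive_in orc
      (\<lambda>x. Option.bind (f x) (\<lambda>a. Option.bind (g x) (\<lambda>b. Some (prod_encode (a, b)))))"
| comp: "partial_recursive_in orc f \<Longrightarrow> partial_recursive_in orc g \<Longrightarrow>
    partial_recursive_in orc (f \<circ>\<^sub>m g)"
| prec: "partial_recursive_in orc f \<Longrightarrow> partial_recursive_in orc g \<Longrightarrow>
    partial_recursive_in orc (\<lambda>x. prec_pfun f g (fst (prod_decode x)) (snd (prod_decode x)))"
| mu: "partial_recursive_in orc f \<Longrightarrow> partial_recursive_in orc (mu_pfun f)"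

definition turing_le :: "(nat \<Rightarrow> nat) \<Rightarrow> (nat \<Rightarrow> nat) \<Rightarrow> bool"  (infix \<open>\<le>\<^sub>T\<close> 50) where
  "g \<le>\<^sub>T f \<longleftrightarrow> partial_recursive_in f (\<lambda>x. Some (g x))"

definition computable :: "(nat \<Rightarrow> nat) \<Rightarrow> bool" where
  "computable g \<longleftrightarrow> g \<le>\<^sub>T (\<lambda>_. 0)"


subsection \<open>The arithmetical hierarchy and genericity\<close>

text \<open>
  Level \<open>0\<close> consists of the computable sets. A set is \<open>\<Sigma>\<^sup>0\<close> of level \<open>n + 1\<close> iff it is the
  projection of a \<open>\<Pi>\<^sup>0\<close> set of level \<open>n\<close>, that is, of the complement of a \<open>\<Sigma>\<^sup>0\<close> set of
  level \<open>n\<close>.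
\<close>

primrec Sigma0 :: "nat \<Rightarrow> nat set \<Rightarrow> bool" where
  "Sigma0 0 A \<longleftrightarrow> computable (indicator A)"
| "Sigma0 (Suc n) A \<longleftrightarrow> (\<exists>B. Sigma0 n (- B) \<and> A = {x. \<exists>y. prod_encode (x, y) \<in> B})"

text \<open>Finite strings are coded by the effective bijection \<^const>\<open>list_encode\<close>.\<close>

definition Sigma0_strings :: "nat \<Rightarrow> nat list set \<Rightarrow> bool" where
  "Sigma0_strings n W \<longleftrightarrow> Sigma0 n (list_encode ` W)"

definition initial_segment :: "(nat \<Rightarrow> nat) \<Rightarrow> nat \<Rightarrow> nat list" where
  "initial_segment f k = map f [0..<k]"

definition generic :: "nat \<Rightarrow> (nat \<Rightarrow> nat) \<Rightarrow> bool" where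
  "generic n f \<longleftrightarrow>
     (\<forall>W. Sigma0_strings n W \<longrightarrow>
        (\<exists>k. initial_segment f k \<in> W \<or> \<not> (\<exists>\<tau>\<in>W. prefix (initial_segment f k) \<tau>)))"


subsection \<open>Effective dense descriptions\<close>

definition density_zero :: "nat set \<Rightarrow> bool" where
  "density_zero S \<longleftrightarrow> (\<lambda>l. real (card (S \<inter> {..<l})) / real l) \<longlonglongrightarrow> 0"

text \<open>The symbol \<open>\<box>\<close> is \<^const>\<open>None\<close>.\<close>

definition effective_dense_description :: "(nat \<Rightarrow> nat) \<Rightarrow> (nat \<Rightarrow> nat option) \<Rightarrow> bool" where
  "effective_dense_description f h \<longleftrightarrow>
     (\<forall>x. h x = Some (f x) \<or> h x = None) \<and> density_zero {x. h x = None}"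

definition code_box :: "(nat \<Rightarrow> nat option) \<Rightarrow> nat \<Rightarrow> nat" where
  "code_box h x = (case h x of None \<Rightarrow> 0 | Some y \<Rightarrow> Suc y)"

definition NED_ge :: "(nat \<Rightarrow> nat) \<Rightarrow> (nat \<Rightarrow> nat) \<Rightarrow> bool"  (infix \<open>\<ge>\<^sub>N\<^sub>E\<^sub>D\<close> 50) where
  "f \<ge>\<^sub>N\<^sub>E\<^sub>D g \<longleftrightarrow>
     (\<forall>h. effective_dense_description f h \<longrightarrow>
        (\<exists>k. effective_dense_description g k \<and> code_box k \<le>\<^sub>T code_box h))"

definition NED_equiv :: "(nat \<Rightarrow> nat) \<Rightarrow> (nat \<Rightarrow> nat) \<Rightarrow> bool"  (infix \<open>\<equiv>\<^sub>N\<^sub>E\<^sub>D\<close> 50) where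
  "f \<equiv>\<^sub>N\<^sub>E\<^sub>D g \<longleftrightarrow> f \<ge>\<^sub>N\<^sub>E\<^sub>D g \<and> g \<ge>\<^sub>N\<^sub>E\<^sub>D f"

end

theory Submission
  imports Defs "HOL-Library.Countable"
begin

text \<open>
  Call \<open>z\<close> blank in a description if the description has the value \<open>\<box>\<close> at \<open>z\<close>. The idea is that \<open>f\<close>
  has infinitely many possible values and a set only two: on a long window the values of \<open>f\<close> can be
  changed without any effect on the set up to a point as remote as desired, and from there on a few
  blanks in a description of the set hide the change.

  Suppose \<open>f\<close> and \<open>X\<close> are equivalent. By a Baire category argument (\<open>generic_description\<close>) the reduction
  of \<open>X\<close> to \<open>f\<close> is uniform on a neighbourhood (\<open>NED_ge_uniform\<close>): there are one program \<open>p\<close>, a string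
  \<open>u\<^sub>0\<close> and a number \<open>E\<close> such that every string that extends \<open>u\<^sub>0\<close>, agrees with \<open>f\<close> and has at most a
  fraction \<open>1/E\<close> of blanks can be continued to a description from which \<open>p\<close> computes a description of
  \<open>X\<close>. So the values that \<open>p\<close> computes from such strings are values of \<open>X\<close> (\<open>out_sound\<close>) and are missing
  only on a set of density \<open>0\<close> (\<open>density_zero_undef_out\<close>). This applies in particular when \<open>f\<close> is
  blanked on a window \<open>[m, m + c)\<close> that makes up a fixed fraction, below \<open>1/E\<close>, of \<open>[0, m + c)\<close>. Hence
  beyond some \<open>L\<close> nearly all of \<open>X\<close> is known without looking at \<open>f\<close> on the window.

  By the pigeonhole principle two of the infinitely many constant values on the window lead to the
  same string of values of the set up to \<open>L\<close>. The number \<open>L\<close> depends on \<open>f\<close> beyond the window, so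
  the string that describes the situation also has to force that \<open>L\<close> is large enough. This is the
  \<open>\<Sigma>\<^sub>3\<close> condition for which the genericity is needed (\<open>split_at_dense\<close>, \<open>ex_split\<close>). The outcome is a
  function \<open>f'\<close> that differs from \<open>f\<close> exactly on the window, and a string \<open>t\<close> that is compatible with
  the values computed from \<open>f\<close> and with those computed from \<open>f'\<close>, and that can be continued, with few
  blanks, in such a way that it remains so.

  Let \<open>q\<close> be a program. If it makes no error about \<open>f\<close> on the strings of this kind, then an initial
  segment of \<open>f\<close> forces this, so that it makes no error about \<open>f'\<close> either; but no value is right for
  both on the window. So \<open>q\<close> has no output on the window once \<open>t\<close> is fixed (\<open>defeat_next\<close>). Treating
  every program infinitely often, a second use of \<open>generic_description\<close> gives a description of \<open>X\<close>
  from which each program errs or leaves infinitely many windows blank. Windows have a fixed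
  relative length, so what is computed is never a description of \<open>f\<close> (\<open>not_NED_ge\<close>).

  That the sets in question lie on the required levels of the arithmetical hierarchy rests on
  computations from strings being a \<open>\<Sigma>\<^sub>1\<close> relation for each program (\<open>Sig_1_ev\<close>).
\<close>

section \<open>Computable functions between coded types\<close>

text \<open>
  Predicates of several variables of different types are treated as predicates of one variable of a
  product type, with a code in \<^typ>\<open>nat\<close>. Closure under computable functions then serves for the
  renaming and duplication of variables, and the closure lemmas can be applied by resolution.
\<close>

class coded =
  fixes enc :: "'a \<Rightarrow> nat"
  assumes bij_enc: "bij enc"

definition dec :: "nat \<Rightarrow> 'a::coded" where
  "dec = inv enc"

lemma dec_enc [simp]: "dec (enc x) = x"
  unfolding dec_def using bij_enc by (metis bij_is_inj inv_f_f)

lemma enc_dec [simp]: "enc (dec n :: 'a::coded) = n"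
  unfolding dec_def using bij_enc by (metis bij_is_surj surj_f_inv_f)

lemma dec_eqI: "enc x = n \<Longrightarrow> dec n = x"
  by auto

lemma bij_of_inverse: "(\<And>x. g (f x) = x) \<Longrightarrow> (\<And>y. f (g y) = y) \<Longrightarrow> bij f"
  by (metis bij_betw_byWitness subset_UNIV)

instantiation nat :: coded
begin
definition enc_nat :: "nat \<Rightarrow> nat" where "enc_nat n = n"
instance by standard (auto simp: enc_nat_def[abs_def] bij_def)
end

instantiation prod :: (coded, coded) coded
begin
definition enc_prod :: "'a \<times> 'b \<Rightarrow> nat" where
  "enc_prod p = prod_encode (enc (fst p), enc (snd p))"
instance
  by standard
    (rule bij_of_inverse[where g = "\<lambda>n. (dec (fst (prod_decode n)), dec (snd (prod_decode n)))"],
      simp_all add: enc_prod_def)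
end

instantiation list :: (coded) coded
begin
definition enc_list :: "'a list \<Rightarrow> nat" where
  "enc_list xs = list_encode (map enc xs)"
instance
  by standard
    (rule bij_of_inverse[where g = "\<lambda>n. map dec (list_decode n)"], simp_all add: enc_list_def comp_def)
end

lemma enc_pair: "enc (x, y) = prod_encode (enc x, enc y)"
  by (simp add: enc_prod_def)

lemma dec_prod: "dec n = (dec (fst (prod_decode n)), dec (snd (prod_decode n)))"
  by (rule dec_eqI) (simp add: enc_prod_def)

lemma dec_nat [simp]: "dec n = (n::nat)"
  by (rule dec_eqI) (simp add: enc_nat_def)

lemma enc_nat_list: "enc (xs :: nat list) = list_encode xs"
  by (simp add: enc_list_def enc_nat_def[abs_def])

definition rec_fun :: "('a::coded \<Rightarrow> 'b::coded) \<Rightarrow> bool" where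
  "rec_fun f \<longleftrightarrow> computable (\<lambda>n. enc (f (dec n)))"

lemma computable_comp: "computable f \<Longrightarrow> computable g \<Longrightarrow> computable (\<lambda>x. f (g x))"
  unfolding computable_def turing_le_def
  using partial_recursive_in.comp[of "\<lambda>_. 0" "\<lambda>x. Some (f x)" "\<lambda>x. Some (g x)"]
  by (simp add: map_comp_def)

lemma computable_pair: "computable f \<Longrightarrow> computable g \<Longrightarrow> computable (\<lambda>x. prod_encode (f x, g x))"
  unfolding computable_def turing_le_def
  using partial_recursive_in.pair[of "\<lambda>_. 0" "\<lambda>x. Some (f x)" "\<lambda>x. Some (g x)"] by simp

lemma computable_fst: "computable (\<lambda>x. fst (prod_decode x))"
  unfolding computable_def turing_le_def by (rule partial_recursive_in.left)

lemma computable_snd: "computable (\<lambda>x. snd (prod_decode x))"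
  unfolding computable_def turing_le_def by (rule partial_recursive_in.right)

lemma computable_Suc: "computable Suc"
  unfolding computable_def turing_le_def using partial_recursive_in.succ by simp

lemma computable_const: "computable (\<lambda>_. c)"
proof (induction c)
  case 0
  then show ?case
    unfolding computable_def turing_le_def by (rule partial_recursive_in.zero)
next
  case (Suc c)
  then show ?case using computable_comp[OF computable_Suc] by blast
qed

lemma computable_id: "computable (\<lambda>x. x)"
  using computable_pair[OF computable_fst computable_snd] by simp

lemma computable_rec:
  assumes "computable f" "computable g"
  shows "computable (\<lambda>x. rec_nat (f (fst (prod_decode x)))
    (\<lambda>n i. g (prod_encode (fst (prod_decode x), prod_encode (n, i)))) (snd (prod_decode x)))"
proof -
  have "prec_pfun (\<lambda>x. Some (f x)) (\<lambda>x. Some (g x)) a n =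
      Some (rec_nat (f a) (\<lambda>n i. g (prod_encode (a, prod_encode (n, i)))) n)" for a n
    by (induction n) auto
  then show ?thesis
    using partial_recursive_in.prec[of "\<lambda>_. 0" "\<lambda>x. Some (f x)" "\<lambda>x. Some (g x)"] assms
    unfolding computable_def turing_le_def by simp
qed

lemma rec_fun_comp: "rec_fun f \<Longrightarrow> rec_fun g \<Longrightarrow> rec_fun (\<lambda>x. f (g x))"
  unfolding rec_fun_def by (drule (1) computable_comp) simp

named_theorems rec_intros

lemma rec_fun_id [rec_intros]: "rec_fun (\<lambda>x. x)"
  by (simp add: rec_fun_def computable_id)

lemma rec_fun_const [rec_intros]: "rec_fun (\<lambda>_. c)"
  by (simp add: rec_fun_def computable_const)

lemma rec_fun_enc [rec_intros]: "rec_fun f \<Longrightarrow> rec_fun (\<lambda>x. enc (f x))"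
  by (simp add: rec_fun_def enc_nat_def)

lemma rec_fun_dec [rec_intros]: "rec_fun f \<Longrightarrow> rec_fun (\<lambda>x. dec (f x))"
  by (simp add: rec_fun_def enc_nat_def)

lemma rec_fun_Pair [rec_intros]: "rec_fun f \<Longrightarrow> rec_fun g \<Longrightarrow> rec_fun (\<lambda>x. (f x, g x))"
  unfolding rec_fun_def by (drule (1) computable_pair) (simp add: enc_pair)

lemma rec_fun_fst [rec_intros]: "rec_fun f \<Longrightarrow> rec_fun (\<lambda>x. fst (f x))"
  by (rule rec_fun_comp[of fst]) (simp_all add: rec_fun_def dec_prod computable_fst)

lemma rec_fun_snd [rec_intros]: "rec_fun f \<Longrightarrow> rec_fun (\<lambda>x. snd (f x))"
  by (rule rec_fun_comp[of snd]) (simp_all add: rec_fun_def dec_prod computable_snd)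

lemma rec_fun_prod_encode [rec_intros]:
  assumes "rec_fun f" shows "rec_fun (\<lambda>x. prod_encode (f x))"
proof -
  have "prod_encode (f x) = enc (f x)" for x
    by (simp add: enc_prod_def enc_nat_def)
  then show ?thesis using rec_fun_enc[OF assms] by simp
qed

lemma rec_fun_prod_decode [rec_intros]:
  assumes "rec_fun f" shows "rec_fun (\<lambda>x. prod_decode (f x))"
proof -
  have "prod_decode (f x) = dec (f x)" for x
    by (simp add: dec_prod)
  then show ?thesis using rec_fun_dec[OF assms] by simp
qed

lemma rec_fun_Suc [rec_intros]: "rec_fun f \<Longrightarrow> rec_fun (\<lambda>x. Suc (f x))"
  by (rule rec_fun_comp[of Suc]) (simp_all add: rec_fun_def enc_nat_def computable_Suc)

lemma rec_fun_rec [rec_intros]: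
  fixes a :: "'a::coded \<Rightarrow> 'b::coded"
  assumes "rec_fun a" "rec_fun (\<lambda>q. g (fst q) (fst (snd q)) (snd (snd q)))" "rec_fun n"
  shows "rec_fun (\<lambda>x. rec_nat (a x) (g x) (n x))"
proof -
  let ?G = "\<lambda>m. enc (g (dec (fst (prod_decode m))) (fst (prod_decode (snd (prod_decode m))))
     (dec (snd (prod_decode (snd (prod_decode m))))))"
  have "enc (rec_nat (a x) (g x) n) =
      rec_nat (enc (a x)) (\<lambda>n i. ?G (prod_encode (enc x, prod_encode (n, i)))) n" for x n
    by (induction n) (simp, simp, metis dec_enc)
  moreover have "computable (\<lambda>n. enc (a (dec n)))" "computable ?G"
    using assms by (simp_all add: rec_fun_def dec_prod)
  ultimately have "rec_fun (\<lambda>p. rec_nat (a (fst p)) (g (fst p)) (snd p))"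
    unfolding rec_fun_def dec_prod
    using computable_rec[of "\<lambda>n. enc (a (dec n))" ?G] by simp
  from rec_fun_comp[OF this rec_fun_Pair[OF rec_fun_id assms(3)]] show ?thesis by simp
qed

lemma rec_fun_add [rec_intros]:
  assumes "rec_fun f" "rec_fun g" shows "rec_fun (\<lambda>x. f x + g x :: nat)"
proof -
  have "rec_nat m (\<lambda>_. Suc) n = m + n" for m n by (induction n) auto
  moreover have "rec_fun (\<lambda>x. rec_nat (f x) (\<lambda>_. Suc) (g x))"
    by (intro rec_intros assms)
  ultimately show ?thesis by simp
qed

lemma rec_fun_pred:
  assumes "rec_fun f" shows "rec_fun (\<lambda>x. f x - Suc 0)"
proof -
  have "rec_nat 0 (\<lambda>i _. i) n = n - Suc 0" for n by (induction n) auto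
  moreover have "rec_fun (\<lambda>x. rec_nat 0 (\<lambda>i _. i) (f x))"
    by (intro rec_intros assms)
  ultimately show ?thesis by simp
qed

lemma rec_fun_diff [rec_intros]:
  assumes "rec_fun f" "rec_fun g" shows "rec_fun (\<lambda>x. f x - g x :: nat)"
proof -
  have "rec_nat m (\<lambda>_ y. y - Suc 0) n = m - n" for m n by (induction n) auto
  moreover have "rec_fun (\<lambda>x. rec_nat (f x) (\<lambda>_ y. y - Suc 0) (g x))"
    by (intro rec_intros rec_fun_pred assms)
  ultimately show ?thesis by simp
qed

lemma rec_fun_sum [rec_intros]:
  fixes h :: "'a::coded \<Rightarrow> nat \<Rightarrow> nat"
  assumes "rec_fun (\<lambda>q. h (fst q) (snd q))" "rec_fun n"
  shows "rec_fun (\<lambda>x. \<Sum>i<n x. h x i)"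
proof -
  have "rec_nat 0 (\<lambda>i y. y + h x i) n = (\<Sum>i<n. h x i)" for n x by (induction n) auto
  moreover have "rec_fun (\<lambda>x. rec_nat 0 (\<lambda>i y. y + h x i) (n x))"
    by (intro rec_intros assms rec_fun_comp[OF assms(1), of "\<lambda>q. (fst q, fst (snd q))", simplified])
  ultimately show ?thesis by simp
qed

lemma rec_fun_mult [rec_intros]:
  assumes "rec_fun f" "rec_fun g" shows "rec_fun (\<lambda>x. f x * g x :: nat)"
proof -
  have "rec_fun (\<lambda>x. \<Sum>i<f x. g x)"
    by (intro rec_intros assms rec_fun_comp[OF assms(2), of fst])
  then show ?thesis by simp
qed

text \<open>
  Reading a string with default value \<open>0\<close> beyond its end makes the access function total, hence
  computable without side conditions.
\<close>

definition entry :: "nat list \<Rightarrow> nat \<Rightarrow> nat" where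
  "entry xs i = (if i < length xs then xs ! i else 0)"

lemma enc_tl_hd:
  "enc (tl (dec n :: nat list)) = snd (prod_decode (n - 1))"
  "(case dec n of [] \<Rightarrow> 0 | x # _ \<Rightarrow> x) = fst (prod_decode (n - 1))"
proof -
  have z: "prod_decode 0 = (0, 0)"
    by (simp add: prod_decode_def prod_decode_aux.simps)
  obtain xs :: "nat list" where xs: "n = enc xs" by (metis enc_dec)
  show "enc (tl (dec n :: nat list)) = snd (prod_decode (n - 1))"
    unfolding xs dec_enc by (cases xs) (simp_all add: enc_nat_list z)
  show "(case dec n of [] \<Rightarrow> 0 | x # _ \<Rightarrow> x) = fst (prod_decode (n - 1))"
    unfolding xs dec_enc by (cases xs) (simp_all add: enc_nat_list z)
qed

lemma rec_fun_drop [rec_intros]: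
  fixes f :: "'a::coded \<Rightarrow> nat list"
  assumes "rec_fun f" "rec_fun n" shows "rec_fun (\<lambda>x. drop (n x) (f x))"
proof -
  have tl: "rec_fun (tl :: nat list \<Rightarrow> nat list)"
    unfolding rec_fun_def enc_tl_hd(1)
    using computable_comp[OF computable_snd]
      rec_fun_pred[of "\<lambda>x::nat. x", OF rec_fun_id]
    by (simp add: rec_fun_def enc_nat_def)
  have "rec_nat xs (\<lambda>_. tl) k = drop k xs" for xs :: "nat list" and k
    by (induction k) (auto simp: drop_Suc tl_drop)
  moreover have "rec_fun (\<lambda>x. rec_nat (f x) (\<lambda>_. tl) (n x))"
    by (intro rec_intros assms rec_fun_comp[OF tl])
  ultimately show ?thesis by simp
qed

lemma rec_fun_entry [rec_intros]:
  assumes "rec_fun f" "rec_fun n" shows "rec_fun (\<lambda>x. entry (f x) (n x))"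
proof -
  let ?hd = "\<lambda>xs :: nat list. case xs of [] \<Rightarrow> 0 | x # _ \<Rightarrow> x"
  have hd: "rec_fun ?hd"
    unfolding rec_fun_def enc_tl_hd(2)
    using computable_comp[OF computable_fst]
      rec_fun_pred[of "\<lambda>x::nat. x", OF rec_fun_id]
    by (simp add: rec_fun_def enc_nat_def)
  have "entry xs i = ?hd (drop i xs)" for xs i
    by (cases "i < length xs") (auto simp: entry_def Cons_nth_drop_Suc[symmetric])
  then show ?thesis
    using rec_fun_comp[OF hd rec_fun_drop[OF assms]] by simp
qed

lemma length_le_enc: "length xs \<le> enc (xs :: nat list)"
proof (induction xs)
  case (Cons x xs)
  then show ?case
    using le_prod_encode_2[of "list_encode xs" x] by (simp add: enc_nat_list)
qed simp

lemma rec_fun_length [rec_intros]: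
  fixes f :: "'a::coded \<Rightarrow> nat list"
  assumes "rec_fun f" shows "rec_fun (\<lambda>x. length (f x))"
proof -
  \<comment> \<open>The length counts the nonempty tails, and there are at most as many as the code.\<close>
  have len: "length xs = (\<Sum>i<enc xs. 1 - (1 - enc (drop i xs)))" for xs :: "nat list"
  proof -
    have nz: "enc ys = 0 \<longleftrightarrow> ys = []" for ys :: "nat list"
      by (cases ys) (simp_all add: enc_nat_list)
    have "1 - (1 - enc (drop i xs)) = (if i < length xs then 1 else 0)" for i
      using nz[of "drop i xs"] by (cases "i < length xs") auto
    then have "(\<Sum>i<enc xs. 1 - (1 - enc (drop i xs))) = (\<Sum>i<enc xs. if i < length xs then 1 else 0)"
      by (simp only:)
    also have "\<dots> = (\<Sum>i<length xs. if i < length xs then 1 else 0)"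
      by (rule sum.mono_neutral_right) (use length_le_enc[of xs] in auto)
    finally show ?thesis by simp
  qed
  show ?thesis
    unfolding len
    by (intro rec_intros assms rec_fun_comp[OF assms, of fst])
qed

section \<open>Closure properties of the arithmetical hierarchy\<close>

definition Sig :: "nat \<Rightarrow> ('a::coded \<Rightarrow> bool) \<Rightarrow> bool" where
  "Sig n P \<longleftrightarrow> Sigma0 n {k. P (dec k)}"

lemma Sigma0_strings_iff_Sig: "Sigma0_strings n W \<longleftrightarrow> Sig n (\<lambda>\<tau>. \<tau> \<in> W)"
proof -
  have "{k. dec k \<in> W} = enc ` W"
    by (force simp: image_iff intro: enc_dec[symmetric])
  then show ?thesis
    by (simp add: Sigma0_strings_def Sig_def enc_nat_list[abs_def])
qed

lemma Sig_0: "Sig 0 P \<longleftrightarrow> rec_fun (\<lambda>x. of_bool (P x) :: nat)"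
  by (simp add: Sig_def rec_fun_def enc_nat_def indicator_def[abs_def])

lemma Sig_Suc: "Sig (Suc n) P \<longleftrightarrow> (\<exists>Q. Sig n (\<lambda>q. \<not> Q q) \<and> (\<forall>x. P x \<longleftrightarrow> (\<exists>y::nat. Q (x, y))))"
proof
  assume "Sig (Suc n) P"
  then obtain B where B: "Sigma0 n (- B)" "{k. P (dec k)} = {x. \<exists>y. prod_encode (x, y) \<in> B}"
    by (auto simp: Sig_def)
  have "Sig n (\<lambda>q. \<not> enc q \<in> B)"
    using B(1) by (simp add: Sig_def Compl_eq)
  moreover have "P x \<longleftrightarrow> (\<exists>y::nat. enc (x, y) \<in> B)" for x
    using B(2)[unfolded set_eq_iff, rule_format, of "enc x"]
    by (simp add: enc_pair enc_nat_def)
  ultimately show "\<exists>Q. Sig n (\<lambda>q. \<not> Q q) \<and> (\<forall>x. P x \<longleftrightarrow> (\<exists>y::nat. Q (x, y)))"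
    by (intro exI[of _ "\<lambda>q. enc q \<in> B"]) simp
next
  assume "\<exists>Q. Sig n (\<lambda>q. \<not> Q q) \<and> (\<forall>x. P x \<longleftrightarrow> (\<exists>y::nat. Q (x, y)))"
  then obtain Q where Q: "Sig n (\<lambda>q. \<not> Q q)" "\<And>x. P x \<longleftrightarrow> (\<exists>y::nat. Q (x, y))"
    by auto
  then have "Sigma0 n (- {k. Q (dec k)})"
    by (simp add: Sig_def Compl_eq)
  moreover have "{k. P (dec k)} = {x. \<exists>y. prod_encode (x, y) \<in> {k. Q (dec k)}}"
    by (auto simp: Q(2) dec_prod)
  ultimately show "Sig (Suc n) P"
    unfolding Sig_def Sigma0.simps by blast
qed

lemma Sig_cong: "Sig n P \<Longrightarrow> (\<And>x. P x \<longleftrightarrow> Q x) \<Longrightarrow> Sig n Q"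
  by (simp add: Sig_def)

text \<open>
  The inductions on the level run over predicates on \<^typ>\<open>nat\<close>: the quantifier changes the type of
  the argument, which an induction hypothesis cannot follow.
\<close>

lemma Sig_iff_nat: "Sig n P \<longleftrightarrow> Sig n (\<lambda>k::nat. P (dec k))"
  by (simp add: Sig_def)

lemma Sig_Suc_nat:
  fixes P :: "nat \<Rightarrow> bool"
  shows "Sig (Suc n) P \<longleftrightarrow>
    (\<exists>Q :: nat \<Rightarrow> bool. Sig n (\<lambda>q. \<not> Q q) \<and> (\<forall>x. P x \<longleftrightarrow> (\<exists>y. Q (prod_encode (x, y)))))"
    (is "_ \<longleftrightarrow> ?R")
proof
  assume "Sig (Suc n) P"
  then obtain Q where Q: "Sig n (\<lambda>q. \<not> Q q)" "\<And>x. P x \<longleftrightarrow> (\<exists>y::nat. Q (x, y))"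
    by (auto simp: Sig_Suc)
  have "Sig n (\<lambda>k::nat. \<not> Q (dec k))"
    using Q(1) by (rule Sig_iff_nat[THEN iffD1])
  with Q(2) show ?R
    by (intro exI[of _ "\<lambda>k. Q (dec k)"]) (simp add: dec_prod)
next
  assume ?R
  then obtain Q :: "nat \<Rightarrow> bool" where
    Q: "Sig n (\<lambda>q. \<not> Q q)" "\<And>x. P x \<longleftrightarrow> (\<exists>y. Q (prod_encode (x, y)))"
    by auto
  have "Sig n (\<lambda>q :: nat \<times> nat. \<not> Q (enc q))"
    using Q(1) by (simp add: Sig_def)
  with Q(2) show "Sig (Suc n) P"
    unfolding Sig_Suc by (intro exI[of _ "\<lambda>q. Q (enc q)"]) (simp add: enc_pair enc_nat_def)
qed

lemma Sig_subst_nat: "Sig n P \<Longrightarrow> rec_fun f \<Longrightarrow> Sig n (\<lambda>x::nat. P (f x :: nat))"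
proof (induction n arbitrary: P f)
  case 0
  then show ?case
    by (simp add: Sig_0 rec_fun_comp[of "\<lambda>x. of_bool (P x)"])
next
  case (Suc n)
  from Suc.prems(1) obtain Q :: "nat \<Rightarrow> bool" where
    Q: "Sig n (\<lambda>q. \<not> Q q)" "\<And>x. P x \<longleftrightarrow> (\<exists>y. Q (prod_encode (x, y)))"
    by (auto simp: Sig_Suc_nat)
  let ?Q = "\<lambda>q. Q (prod_encode (f (fst (prod_decode q)), snd (prod_decode q)))"
  have "Sig n (\<lambda>q. \<not> ?Q q)"
    by (intro Suc.IH[OF Q(1)] rec_intros rec_fun_comp[OF Suc.prems(2)])
  with Q(2) show ?case
    unfolding Sig_Suc_nat by (intro exI[of _ ?Q]) simp
qed

lemma Sig_subst: "Sig n P \<Longrightarrow> rec_fun f \<Longrightarrow> Sig n (\<lambda>x. P (f x))"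
proof -
  assume "Sig n P" "rec_fun f"
  have 1: "Sig n (\<lambda>k::nat. P (dec k))"
    using \<open>Sig n P\<close> by (rule Sig_iff_nat[THEN iffD1])
  have 2: "rec_fun (\<lambda>k::nat. enc (f (dec k)))"
    by (rule rec_fun_enc[OF rec_fun_comp[OF \<open>rec_fun f\<close> rec_fun_dec[OF rec_fun_id]]])
  from Sig_subst_nat[OF 1 2] have "Sig n (\<lambda>k::nat. P (f (dec k)))"
    by (simp only: dec_enc)
  then show ?thesis by (rule Sig_iff_nat[THEN iffD2])
qed

lemma Sig_0_not: "Sig 0 P \<Longrightarrow> Sig 0 (\<lambda>x. \<not> P x)"
proof -
  assume "Sig 0 P"
  then have "rec_fun (\<lambda>x. 1 - of_bool (P x) :: nat)"
    unfolding Sig_0 by (intro rec_intros)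
  moreover have "1 - of_bool b = (of_bool (\<not> b) :: nat)" for b by simp
  ultimately show ?thesis by (simp add: Sig_0)
qed

lemma Sig_not_Suc: "Sig n (\<lambda>x. \<not> P x) \<Longrightarrow> Sig (Suc n) P"
  unfolding Sig_Suc
  by (rule exI[of _ "\<lambda>q. P (fst q)"])
    (simp add: Sig_subst[of n "\<lambda>x. \<not> P x" fst] rec_fun_fst rec_fun_id)

lemma Sig_Suc_mono: "Sig n P \<Longrightarrow> Sig (Suc n) P"
proof -
  have nat: "Sig n P \<Longrightarrow> Sig (Suc n) P" for n and P :: "nat \<Rightarrow> bool"
  proof (induction n arbitrary: P)
    case 0
    then show ?case by (intro Sig_not_Suc Sig_0_not)
  next
    case (Suc n)
    from Suc.prems obtain Q :: "nat \<Rightarrow> bool" where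
      "Sig n (\<lambda>q. \<not> Q q)" "\<And>x. P x \<longleftrightarrow> (\<exists>y. Q (prod_encode (x, y)))"
      by (auto simp: Sig_Suc_nat)
    then show ?case
      unfolding Sig_Suc_nat[of "Suc n"] by (intro exI[of _ Q] conjI Suc.IH allI)
  qed
  assume "Sig n P"
  then have "Sig n (\<lambda>k::nat. P (dec k))" by (rule Sig_iff_nat[THEN iffD1])
  from nat[OF this] show ?thesis by (rule Sig_iff_nat[THEN iffD2])
qed

lemma ex_prod_decode: "(\<exists>j. R (fst (prod_decode j)) (snd (prod_decode j))) \<longleftrightarrow> (\<exists>a b. R a b)"
  by (metis fst_conv prod_encode_inverse snd_conv)

lemma Sig_conj_disj:
  assumes "Sig n P" "Sig n P'"
  shows "Sig n (\<lambda>x. P x \<and> P' x) \<and> Sig n (\<lambda>x. P x \<or> P' x)"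
proof -
  have nat: "Sig n P \<Longrightarrow> Sig n P' \<Longrightarrow> Sig n (\<lambda>x. P x \<and> P' x) \<and> Sig n (\<lambda>x. P x \<or> P' x)"
    for n and P P' :: "nat \<Rightarrow> bool"
  proof (induction n arbitrary: P P')
    case 0
    have c: "Sig 0 (\<lambda>x. P x \<and> P' x)" if "Sig 0 P" "Sig 0 P'" for P P' :: "nat \<Rightarrow> bool"
    proof -
      have "rec_fun (\<lambda>x. of_bool (P x) * of_bool (P' x) :: nat)"
        using that unfolding Sig_0 by (intro rec_intros)
      then show ?thesis by (simp add: Sig_0 of_bool_conj)
    qed
    show ?case
      using c[OF 0] Sig_0_not[OF c[OF Sig_0_not[OF 0(1)] Sig_0_not[OF 0(2)]]] by simp
  next
    case (Suc n)
    from Suc.prems(1) obtain Q :: "nat \<Rightarrow> bool" where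
      Q: "Sig n (\<lambda>q. \<not> Q q)" "\<And>x. P x \<longleftrightarrow> (\<exists>y. Q (prod_encode (x, y)))"
      by (auto simp: Sig_Suc_nat)
    from Suc.prems(2) obtain Q' :: "nat \<Rightarrow> bool" where
      Q': "Sig n (\<lambda>q. \<not> Q' q)" "\<And>x. P' x \<longleftrightarrow> (\<exists>y. Q' (prod_encode (x, y)))"
      by (auto simp: Sig_Suc_nat)
    \<comment> \<open>One quantifier ranges over pairs of witnesses.\<close>
    let ?f = "\<lambda>q. prod_encode (fst (prod_decode q), fst (prod_decode (snd (prod_decode q))))"
    let ?g = "\<lambda>q. prod_encode (fst (prod_decode q), snd (prod_decode (snd (prod_decode q))))"
    have "Sig n (\<lambda>q. \<not> Q (?f q))" "Sig n (\<lambda>q. \<not> Q' (?g q))"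
      by (intro Sig_subst[OF Q(1)] Sig_subst[OF Q'(1)] rec_intros)+
    from Suc.IH[OF this]
    have s: "Sig n (\<lambda>q. \<not> (Q (?f q) \<and> Q' (?g q)))" "Sig n (\<lambda>q. \<not> (Q (?f q) \<or> Q' (?g q)))"
      by simp_all
    have "(P x \<and> P' x) \<longleftrightarrow> (\<exists>y. Q (?f (prod_encode (x, y))) \<and> Q' (?g (prod_encode (x, y))))" for x
      using ex_prod_decode[of "\<lambda>a b. Q (prod_encode (x, a)) \<and> Q' (prod_encode (x, b))"]
      by (simp add: Q(2) Q'(2))
    with s(1) have "Sig (Suc n) (\<lambda>x. P x \<and> P' x)"
      unfolding Sig_Suc_nat by (intro exI[of _ "\<lambda>q. Q (?f q) \<and> Q' (?g q)"] conjI allI)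
    moreover have "(P x \<or> P' x) \<longleftrightarrow> (\<exists>y. Q (?f (prod_encode (x, y))) \<or> Q' (?g (prod_encode (x, y))))" for x
      using ex_prod_decode[of "\<lambda>a b. Q (prod_encode (x, a)) \<or> Q' (prod_encode (x, b))"]
      by (simp add: Q(2) Q'(2))
    with s(2) have "Sig (Suc n) (\<lambda>x. P x \<or> P' x)"
      unfolding Sig_Suc_nat by (intro exI[of _ "\<lambda>q. Q (?f q) \<or> Q' (?g q)"] conjI allI)
    ultimately show ?case ..
  qed
  from nat[OF assms[THEN Sig_iff_nat[THEN iffD1]]] show ?thesis
    using Sig_iff_nat[of n "\<lambda>x. P x \<and> P' x"] Sig_iff_nat[of n "\<lambda>x. P x \<or> P' x"] by simp
qed

lemma Sig_conj: "Sig n P \<Longrightarrow> Sig n P' \<Longrightarrow> Sig n (\<lambda>x. P x \<and> P' x)"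
  using Sig_conj_disj by blast

lemma Sig_disj: "Sig n P \<Longrightarrow> Sig n P' \<Longrightarrow> Sig n (\<lambda>x. P x \<or> P' x)"
  using Sig_conj_disj by blast

lemma Sig_ex:
  fixes P :: "'a::coded \<Rightarrow> 'b::coded \<Rightarrow> bool"
  assumes "Sig (Suc n) (\<lambda>q. P (fst q) (snd q))"
  shows "Sig (Suc n) (\<lambda>x. \<exists>y. P x y)"
proof -
  obtain Q where Q: "Sig n (\<lambda>q. \<not> Q q)" "\<And>q. P (fst q) (snd q) \<longleftrightarrow> (\<exists>i::nat. Q (q, i))"
    using assms by (auto simp: Sig_Suc)
  let ?f = "\<lambda>q :: 'a \<times> nat. ((fst q, dec (fst (prod_decode (snd q))) :: 'b), snd (prod_decode (snd q)))"
  have "Sig n (\<lambda>q. \<not> Q (?f q))"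
    by (intro Sig_subst[OF Q(1)] rec_intros)
  moreover have "(\<exists>y. P x y) \<longleftrightarrow> (\<exists>j. Q (?f (x, j)))" for x
  proof -
    have "(\<exists>y. P x y) \<longleftrightarrow> (\<exists>y i. Q ((x, y), i))"
      using Q(2)[of "(x, _)"] by simp
    also have "\<dots> \<longleftrightarrow> (\<exists>k i. Q ((x, dec k), i))"
      by (metis dec_enc)
    also have "\<dots> \<longleftrightarrow> (\<exists>j. Q (?f (x, j)))"
      using ex_prod_decode[of "\<lambda>k i. Q ((x, dec k), i)"] by simp
    finally show ?thesis .
  qed
  ultimately show ?thesis
    unfolding Sig_Suc by (intro exI[of _ "\<lambda>q. Q (?f q)"] conjI allI)
qed

lemma Sig_0_all_less:
  fixes P :: "'a::coded \<Rightarrow> nat \<Rightarrow> bool"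
  assumes "Sig 0 (\<lambda>q. P (fst q) (snd q))" "rec_fun b"
  shows "Sig 0 (\<lambda>x. \<forall>i<b x. P x i)"
proof -
  have "rec_fun (\<lambda>x. 1 - (\<Sum>i<b x. 1 - of_bool (P x i)) :: nat)"
    using assms unfolding Sig_0 by (intro rec_intros)
  moreover have "1 - (\<Sum>i<n. 1 - of_bool (P x i)) = (of_bool (\<forall>i<n. P x i) :: nat)" for x n
  proof (cases "\<forall>i<n. P x i")
    case False
    then obtain i where "i < n" "\<not> P x i" by auto
    then have "1 \<le> (\<Sum>i<n. 1 - of_bool (P x i) :: nat)"
      using member_le_sum[of i "{..<n}" "\<lambda>i. 1 - of_bool (P x i) :: nat"] by simp
    with False show ?thesis by simp
  qed simp
  ultimately show ?thesis by (simp add: Sig_0)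
qed

lemma Sig_1_all_less:
  fixes P :: "'a::coded \<Rightarrow> nat \<Rightarrow> bool"
  assumes "Sig 1 (\<lambda>q. P (fst q) (snd q))" "rec_fun b"
  shows "Sig 1 (\<lambda>x. \<forall>i<b x. P x i)"
proof -
  obtain Q where Q: "Sig 0 (\<lambda>q. \<not> Q q)" "\<And>q. P (fst q) (snd q) \<longleftrightarrow> (\<exists>y::nat. Q (q, y))"
    using assms(1) by (auto simp: Sig_Suc)
  \<comment> \<open>Finitely many witnesses have a common bound, which leaves only bounded quantifiers.\<close>
  have all: "Sig 0 (\<lambda>q. \<forall>y<snd (fst q). \<not> Q ((fst (fst q), snd q), y))"
    by (intro Sig_0_all_less Sig_subst[OF Q(1)] rec_intros)
  have "Sig 0 (\<lambda>q. \<forall>i<b (fst q). \<not> (\<forall>y<snd q. \<not> Q ((fst q, i), y)))"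
    by (intro Sig_0_all_less Sig_0_not all rec_intros rec_fun_comp[OF assms(2)])
  then have "Sig 0 (\<lambda>q. \<not> (\<forall>i<b (fst q). \<exists>y<snd q. Q ((fst q, i), y)))"
    by (intro Sig_0_not) simp
  moreover have "(\<forall>i<b x. P x i) \<longleftrightarrow> (\<exists>B. \<forall>i<b x. \<exists>y<B. Q ((x, i), y))" for x
  proof
    assume "\<forall>i<b x. P x i"
    then have "\<forall>i<b x. \<exists>y. Q ((x, i), y)" using Q(2)[of "(x, _)"] by simp
    then obtain y where y: "\<And>i. i < b x \<Longrightarrow> Q ((x, i), y i)" by metis
    have "y i < Suc (\<Sum>j<b x. y j)" if "i < b x" for i
      using member_le_sum[of i "{..<b x}" y] that by simp
    with y show "\<exists>B. \<forall>i<b x. \<exists>y<B. Q ((x, i), y)" by blast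
  next
    assume "\<exists>B. \<forall>i<b x. \<exists>y<B. Q ((x, i), y)"
    then show "\<forall>i<b x. P x i" using Q(2)[of "(x, _)"] by simp blast
  qed
  ultimately show ?thesis
    unfolding One_nat_def Sig_Suc
    by (intro exI[of _ "\<lambda>q. \<forall>i<b (fst q). \<exists>y<snd q. Q ((fst q, i), y)"]) simp
qed

lemma Sig_0_le:
  assumes "rec_fun f" "rec_fun g" shows "Sig 0 (\<lambda>x. f x \<le> (g x :: nat))"
proof -
  have "rec_fun (\<lambda>x. 1 - (f x - g x))" by (intro rec_intros assms)
  moreover have "1 - (m - n) = (of_bool (m \<le> n) :: nat)" for m n :: nat by auto
  ultimately show ?thesis by (simp add: Sig_0)
qed

lemma Sig_0_less:
  assumes "rec_fun f" "rec_fun g" shows "Sig 0 (\<lambda>x. f x < (g x :: nat))"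
  unfolding Suc_le_eq[symmetric] by (intro Sig_0_le rec_intros assms)

lemma Sig_0_eq:
  assumes "rec_fun f" "rec_fun g" shows "Sig 0 (\<lambda>x. f x = (g x :: nat))"
  unfolding eq_iff using Sig_conj[OF Sig_0_le[OF assms] Sig_0_le[OF assms(2,1)]] .

lemma Sig_0_imp: "Sig 0 P \<Longrightarrow> Sig 0 Q \<Longrightarrow> Sig 0 (\<lambda>x. P x \<longrightarrow> Q x)"
  unfolding imp_conv_disj by (intro Sig_disj Sig_0_not)

lemma prefix_iff_entry:
  "prefix xs ys \<longleftrightarrow> length xs \<le> length ys \<and> (\<forall>i<length xs. entry xs i = entry ys i)"
proof
  assume "prefix xs ys"
  then show "length xs \<le> length ys \<and> (\<forall>i<length xs. entry xs i = entry ys i)"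
    by (auto simp: prefix_def entry_def nth_append)
next
  assume *: "length xs \<le> length ys \<and> (\<forall>i<length xs. entry xs i = entry ys i)"
  then have "xs = take (length xs) ys"
    by (intro nth_equalityI) (auto simp: entry_def)
  then show "prefix xs ys" by (metis take_is_prefix)
qed

lemma Sig_0_prefix:
  assumes "rec_fun f" "rec_fun g" shows "Sig 0 (\<lambda>x. prefix (f x) (g x :: nat list))"
  unfolding prefix_iff_entry
  by (intro Sig_conj Sig_0_le Sig_0_eq Sig_0_all_less rec_intros assms
      rec_fun_comp[OF assms(1), of fst] rec_fun_comp[OF assms(2), of fst])

lemmas decidable_intros =
  Sig_0_prefix Sig_0_le Sig_0_less Sig_0_eq Sig_0_all_less Sig_0_imp Sig_0_not Sig_conj Sig_disj

lemma Sig_1_of_0: "Sig 0 P \<Longrightarrow> Sig 1 P"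
  using Sig_Suc_mono[of 0] by simp

lemma Sig_1_ex: "Sig 1 (\<lambda>q. P (fst q) (snd q)) \<Longrightarrow> Sig 1 (\<lambda>x. \<exists>y::'b::coded. P x y)"
  using Sig_ex[of 0] by simp

section \<open>Computations from a finite part of the oracle\<close>

datatype prog =
    ProgZero | ProgSucc | ProgLeft | ProgRight | ProgQuery
  | ProgPair prog prog | ProgComp prog prog | ProgRec prog prog | ProgMu prog

instance prog :: countable
  by countable_datatype

text \<open>
  A computation that ends has asked finitely many oracle questions, so it can be described with a
  string as oracle. For primitive recursion the string \<open>w\<close> lists the intermediate values.
\<close>

primrec ev :: "prog \<Rightarrow> nat list \<Rightarrow> nat \<Rightarrow> nat \<Rightarrow> bool" where
  "ev ProgZero u z v \<longleftrightarrow> v = 0"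
| "ev ProgSucc u z v \<longleftrightarrow> v = Suc z"
| "ev ProgLeft u z v \<longleftrightarrow> v = fst (prod_decode z)"
| "ev ProgRight u z v \<longleftrightarrow> v = snd (prod_decode z)"
| "ev ProgQuery u z v \<longleftrightarrow> z < length u \<and> v = entry u z"
| "ev (ProgPair p q) u z v \<longleftrightarrow> (\<exists>a b. ev p u z a \<and> ev q u z b \<and> v = prod_encode (a, b))"
| "ev (ProgComp p q) u z v \<longleftrightarrow> (\<exists>a. ev q u z a \<and> ev p u a v)"
| "ev (ProgRec p q) u z v \<longleftrightarrow> (\<exists>w. length w = Suc (snd (prod_decode z)) \<and>
     ev p u (fst (prod_decode z)) (entry w 0) \<and>
     (\<forall>i<snd (prod_decode z).
        ev q u (prod_encode (fst (prod_decode z), prod_encode (i, entry w i))) (entry w (Suc i))) \<and>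
     v = entry w (snd (prod_decode z)))"
| "ev (ProgMu p) u z v \<longleftrightarrow> ev p u (prod_encode (z, v)) 0 \<and>
     (\<forall>m<v. \<exists>k. ev p u (prod_encode (z, m)) (Suc k))"

lemma length_initial_segment [simp]: "length (initial_segment f n) = n"
  by (simp add: initial_segment_def)

lemma entry_initial_segment: "entry (initial_segment f n) z = (if z < n then f z else 0)"
  by (simp add: initial_segment_def entry_def)

lemma entry_prefix: "prefix u w \<Longrightarrow> z < length u \<Longrightarrow> entry w z = entry u z"
  by (simp add: prefix_iff_entry)

lemma list_eq_iff_entry: "xs = ys \<longleftrightarrow> length xs = length ys \<and> (\<forall>z<length xs. entry xs z = entry ys z)"
  by (auto simp: list_eq_iff_nth_eq entry_def)

lemma prefix_initial_segment: "n \<le> m \<Longrightarrow> prefix (initial_segment f n) (initial_segment f m)"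
  by (simp add: prefix_iff_entry entry_initial_segment)

lemma ev_mono: "prefix u w \<Longrightarrow> ev p u z v \<Longrightarrow> ev p w z v"
proof (induction p arbitrary: z v)
  case ProgQuery
  then show ?case
    using entry_prefix[of u w z] prefix_length_le[of u w] by simp
next
  case (ProgPair p q)
  then show ?case unfolding ev.simps by blast
next
  case (ProgComp p q)
  then show ?case unfolding ev.simps by blast
next
  case (ProgRec p q)
  then show ?case unfolding ev.simps by blast
next
  case (ProgMu p)
  then show ?case unfolding ev.simps by blast
qed simp_all

lemma ev_initial_segment_mono:
  "ev p (initial_segment h n) z v \<Longrightarrow> n \<le> m \<Longrightarrow> ev p (initial_segment h m) z v"
  using ev_mono prefix_initial_segment by blast

lemma all_less_ex_common_bound:
  fixes n :: nat
  assumes "\<And>i. i < n \<Longrightarrow> \<exists>m. P i m" "\<And>i m m'. P i m \<Longrightarrow> m \<le> (m' :: nat) \<Longrightarrow> P i m'"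
  shows "\<exists>m. \<forall>i<n. P i m"
  using assms(1)
proof (induction n)
  case (Suc n)
  then obtain m m' where "\<forall>i<n. P i m" "P n m'" by (meson less_Suc_eq)
  then have "\<forall>i<Suc n. P i (max m m')"
    using assms(2) by (metis less_Suc_eq max.cobounded1 max.cobounded2)
  then show ?case ..
qed simp

lemma ev_common_initial_segment:
  assumes "ev p (initial_segment h n) z a" "ev q (initial_segment h m) y b"
  shows "\<exists>n. ev p (initial_segment h n) z a \<and> ev q (initial_segment h n) y b"
  using assms by (intro exI[of _ "max n m"]) (auto elim: ev_initial_segment_mono)

text \<open>
  Stating the values of recursion and minimization with explicit witnesses brings them into the
  form of \<open>ev\<close>, so that only the finitely many oracle questions have to be collected.
\<close>

lemma prec_pfun_eq_Some_iff:
  "prec_pfun f g a n = Some v \<longleftrightarrow> (\<exists>w. length w = Suc n \<and> f a = Some (entry w 0) \<and>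
     (\<forall>i<n. g (prod_encode (a, prod_encode (i, entry w i))) = Some (entry w (Suc i))) \<and>
     v = entry w n)"
proof (induction n arbitrary: v)
  case 0
  have "f a = Some v \<longleftrightarrow> (\<exists>w. length w = Suc 0 \<and> f a = Some (entry w 0) \<and> v = entry w 0)"
    by (auto intro!: exI[of _ "[v]"] simp: entry_def)
  then show ?case by simp
next
  case (Suc n)
  show ?case (is "?L \<longleftrightarrow> ?R")
  proof
    assume ?L
    then obtain i where i: "prec_pfun f g a n = Some i"
        "g (prod_encode (a, prod_encode (n, i))) = Some v"
      by (auto simp: bind_eq_Some_conv)
    then obtain w where w: "length w = Suc n" "f a = Some (entry w 0)"
        "\<forall>i<n. g (prod_encode (a, prod_encode (i, entry w i))) = Some (entry w (Suc i))"
        "i = entry w n"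
      using Suc.IH by blast
    then show ?R
      using i(2) by (intro exI[of _ "w @ [v]"]) (auto simp: entry_def nth_append less_Suc_eq)
  next
    assume ?R
    then obtain w where w: "length w = Suc (Suc n)" "f a = Some (entry w 0)"
        "\<forall>i<Suc n. g (prod_encode (a, prod_encode (i, entry w i))) = Some (entry w (Suc i))"
        "v = entry w (Suc n)"
      by blast
    have "prec_pfun f g a n = Some (entry w n)"
      using w by (subst Suc.IH) (auto intro!: exI[of _ "take (Suc n) w"] simp: entry_def)
    then show ?L using w by simp
  qed
qed

lemma mu_pfun_eq_Some_iff:
  "mu_pfun f a = Some v \<longleftrightarrow> f (prod_encode (a, v)) = Some 0 \<and>
     (\<forall>m<v. \<exists>k. f (prod_encode (a, m)) = Some (Suc k))"
proof -
  have "(LEAST n. f (prod_encode (a, n)) = Some 0) = v"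
    if "f (prod_encode (a, v)) = Some 0" "\<forall>m<v. \<exists>k. f (prod_encode (a, m)) = Some (Suc k)" for v
    using that by (intro Least_equality) (auto simp: not_less[symmetric])
  then show ?thesis unfolding mu_pfun_def by (auto split: if_splits)
qed

text \<open>
  The programs are a countable family that contains all reductions, and each of them has the use
  principle built in: an output depends on an initial segment of the oracle.
\<close>

lemma partial_recursive_in_imp_prog:
  "partial_recursive_in orc F \<Longrightarrow>
    \<exists>p. \<forall>z v. F z = Some v \<longleftrightarrow> (\<exists>n. ev p (initial_segment orc n) z v)"
proof (induction rule: partial_recursive_in.induct)
  case zero
  show ?case by (rule exI[of _ ProgZero]) auto
next
  case succ
  show ?case by (rule exI[of _ ProgSucc]) auto
next
  case left
  show ?case by (rule exI[of _ ProgLeft]) auto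
next
  case right
  show ?case by (rule exI[of _ ProgRight]) auto
next
  case oracle_query
  show ?case by (rule exI[of _ ProgQuery]) (auto simp: entry_initial_segment)
next
  case (pair f g)
  then obtain p q where p: "\<And>z v. f z = Some v \<longleftrightarrow> (\<exists>n. ev p (initial_segment orc n) z v)"
    and q: "\<And>z v. g z = Some v \<longleftrightarrow> (\<exists>n. ev q (initial_segment orc n) z v)" by blast
  have "(\<exists>a b. f z = Some a \<and> g z = Some b \<and> v = prod_encode (a, b)) \<longleftrightarrow>
      (\<exists>n. ev (ProgPair p q) (initial_segment orc n) z v)" for z v
    unfolding p q ev.simps using ev_common_initial_segment[of p orc _ _ _ q] by blast
  moreover have "Option.bind (f z) (\<lambda>a. Option.bind (g z) (\<lambda>b. Some (prod_encode (a, b)))) = Some v \<longleftrightarrow>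
      (\<exists>a b. f z = Some a \<and> g z = Some b \<and> v = prod_encode (a, b))" for z v
    by (auto simp: bind_eq_Some_conv)
  ultimately show ?case
    by (intro exI[of _ "ProgPair p q"] allI) (simp only:)
next
  case (comp f g)
  then obtain p q where p: "\<And>z v. f z = Some v \<longleftrightarrow> (\<exists>n. ev p (initial_segment orc n) z v)"
    and q: "\<And>z v. g z = Some v \<longleftrightarrow> (\<exists>n. ev q (initial_segment orc n) z v)" by blast
  have "(\<exists>a. g z = Some a \<and> f a = Some v) \<longleftrightarrow>
      (\<exists>n. ev (ProgComp p q) (initial_segment orc n) z v)" for z v
    unfolding p q ev.simps using ev_common_initial_segment[of p orc _ _ _ q] by blast
  then show ?case
    by (intro exI[of _ "ProgComp p q"] allI) (simp only: map_comp_Some_iff)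
next
  case (prec f g)
  then obtain p q where p: "\<And>z v. f z = Some v \<longleftrightarrow> (\<exists>n. ev p (initial_segment orc n) z v)"
    and q: "\<And>z v. g z = Some v \<longleftrightarrow> (\<exists>n. ev q (initial_segment orc n) z v)" by blast
  have "prec_pfun f g (fst (prod_decode z)) (snd (prod_decode z)) = Some v \<longleftrightarrow>
      (\<exists>n. ev (ProgRec p q) (initial_segment orc n) z v)" (is "?L \<longleftrightarrow> ?R") for z v
  proof
    let ?a = "fst (prod_decode z)" and ?n = "snd (prod_decode z)"
    assume ?L
    then obtain w where w: "length w = Suc ?n" "f ?a = Some (entry w 0)"
        "\<And>i. i < ?n \<Longrightarrow> g (prod_encode (?a, prod_encode (i, entry w i))) = Some (entry w (Suc i))"
        "v = entry w ?n"
      unfolding prec_pfun_eq_Some_iff by blast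
    obtain n where n: "ev p (initial_segment orc n) ?a (entry w 0)"
      using w(2) p by blast
    obtain m where m: "\<forall>i<?n. ev q (initial_segment orc m)
        (prod_encode (?a, prod_encode (i, entry w i))) (entry w (Suc i))"
      using all_less_ex_common_bound[of ?n "\<lambda>i m. ev q (initial_segment orc m)
        (prod_encode (?a, prod_encode (i, entry w i))) (entry w (Suc i))"]
        w(3) q ev_initial_segment_mono by blast
    show ?R
      unfolding ev.simps
      by (intro exI[of _ "max n m"] exI[of _ w])
        (use w(1,4) n m in \<open>auto elim!: ev_initial_segment_mono\<close>)
  next
    assume ?R
    then show ?L unfolding prec_pfun_eq_Some_iff ev.simps p q by blast
  qed
  then show ?case by blast
next
  case (mu f)
  then obtain p where p: "\<And>z v. f z = Some v \<longleftrightarrow> (\<exists>n. ev p (initial_segment orc n) z v)" by blast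
  have "mu_pfun f z = Some v \<longleftrightarrow> (\<exists>n. ev (ProgMu p) (initial_segment orc n) z v)"
    (is "?L \<longleftrightarrow> ?R") for z v
  proof
    assume ?L
    then have v: "f (prod_encode (z, v)) = Some 0"
      "\<And>m. m < v \<Longrightarrow> \<exists>k. f (prod_encode (z, m)) = Some (Suc k)"
      unfolding mu_pfun_eq_Some_iff by blast+
    obtain n where n: "ev p (initial_segment orc n) (prod_encode (z, v)) 0"
      using v(1) p by blast
    obtain m where m: "\<forall>i<v. \<exists>k. ev p (initial_segment orc m) (prod_encode (z, i)) (Suc k)"
      using all_less_ex_common_bound[of v "\<lambda>i m. \<exists>k. ev p (initial_segment orc m) (prod_encode (z, i)) (Suc k)"]
        v(2) p ev_initial_segment_mono by blast
    show ?R
      unfolding ev.simps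
    proof (rule exI[of _ "max n m"], intro conjI allI impI)
      show "ev p (initial_segment orc (max n m)) (prod_encode (z, v)) 0"
        using n by (rule ev_initial_segment_mono) simp
      fix i assume "i < v"
      with m show "\<exists>k. ev p (initial_segment orc (max n m)) (prod_encode (z, i)) (Suc k)"
        using ev_initial_segment_mono max.cobounded2 by blast
    qed
  next
    assume ?R
    then show ?L unfolding mu_pfun_eq_Some_iff ev.simps p by blast
  qed
  then show ?case by blast
qed

lemma turing_le_imp_prog:
  assumes "g \<le>\<^sub>T h" obtains p where "\<And>z v. g z = v \<longleftrightarrow> (\<exists>n. ev p (initial_segment h n) z v)"
  using partial_recursive_in_imp_prog[OF assms[unfolded turing_le_def]] by auto

lemma Sig_subst_triple:
  assumes "Sig n (\<lambda>q. R (fst q) (fst (snd q)) (snd (snd q)))" "rec_fun u" "rec_fun z" "rec_fun v"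
  shows "Sig n (\<lambda>x. R (u x) (z x) (v x))"
  using Sig_subst[OF assms(1) rec_fun_Pair[OF assms(2) rec_fun_Pair[OF assms(3,4)]]] by simp

lemma Sig_1_ev:
  assumes "rec_fun u" "rec_fun z" "rec_fun v"
  shows "Sig 1 (\<lambda>x. ev p (u x) (z x) (v x))"
proof -
  have "Sig 1 (\<lambda>q :: nat list \<times> nat \<times> nat. ev p (fst q) (fst (snd q)) (snd (snd q)))"
  proof (induction p)
    case (ProgPair p q)
    note IH = this[THEN Sig_subst_triple]
    show ?case
      unfolding ev.simps
      by (intro Sig_1_ex Sig_conj IH Sig_1_of_0[OF Sig_0_eq] rec_intros)
  next
    case (ProgComp p q)
    note IH = this[THEN Sig_subst_triple]
    show ?case
      unfolding ev.simps
      by (intro Sig_1_ex Sig_conj IH rec_intros)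
  next
    case (ProgRec p q)
    note IH = this[THEN Sig_subst_triple]
    show ?case
      unfolding ev.simps
      by (intro Sig_1_ex Sig_conj IH Sig_1_all_less Sig_1_of_0[OF Sig_0_eq] rec_intros)
  next
    case (ProgMu p)
    note IH = this[THEN Sig_subst_triple]
    show ?case
      unfolding ev.simps
      by (intro Sig_1_ex Sig_conj IH Sig_1_all_less rec_intros)
  qed (unfold ev.simps, (intro Sig_1_of_0 Sig_conj Sig_0_eq Sig_0_less rec_intros)+)
  from Sig_subst_triple[OF this assms] show ?thesis .
qed

section \<open>Partial descriptions with few boxes\<close>

definition nbox :: "nat list \<Rightarrow> nat \<Rightarrow> nat" where
  "nbox t l = card {z. z < l \<and> entry t z = 0}"

text \<open>
  The basic neighbourhoods of the space of descriptions: beyond \<open>t\<close>, the string \<open>t'\<close> records only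
  values allowed by \<open>D\<close>, and each of its initial segments that is at least as long as \<open>t\<close> has at
  most a fraction \<open>1/N\<close> of blanks.
\<close>

definition extends :: "(nat \<Rightarrow> nat \<Rightarrow> bool) \<Rightarrow> nat \<Rightarrow> nat list \<Rightarrow> nat list \<Rightarrow> bool" where
  "extends D N t t' \<longleftrightarrow> prefix t t' \<and>
     (\<forall>z<length t'. length t \<le> z \<longrightarrow> entry t' z = 0 \<or> D z (entry t' z - 1)) \<and>
     (\<forall>l<Suc (length t'). length t \<le> l \<longrightarrow> N * nbox t' l \<le> l)"

text \<open>
  The infinite strings in the neighbourhood given by \<open>t\<close>, \<open>D\<close> and \<open>N\<close>.
\<close>

definition fits :: "(nat \<Rightarrow> nat) \<Rightarrow> (nat \<Rightarrow> nat \<Rightarrow> bool) \<Rightarrow> nat \<Rightarrow> nat list \<Rightarrow> bool" where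
  "fits k D N t \<longleftrightarrow> (\<forall>n\<ge>length t. extends D N t (initial_segment k n))"

lemma nbox_eq_sum: "nbox t l = (\<Sum>z<l. 1 - entry t z)"
proof -
  have "(\<Sum>z<l. 1 - entry t z) = (\<Sum>z<l. if entry t z = 0 then 1 else 0)"
    by (rule sum.cong) auto
  also have "\<dots> = card ({..<l} \<inter> {z. entry t z = 0})"
    by (simp add: sum.If_cases)
  also have "{..<l} \<inter> {z. entry t z = 0} = {z. z < l \<and> entry t z = 0}" by auto
  finally show ?thesis by (simp add: nbox_def)
qed

lemma rec_fun_nbox [rec_intros]:
  assumes "rec_fun t" "rec_fun l" shows "rec_fun (\<lambda>x. nbox (t x) (l x))"
  unfolding nbox_eq_sum by (intro rec_intros assms rec_fun_comp[OF assms(1), of fst])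

lemma nbox_cong: "(\<And>z. z < l \<Longrightarrow> entry t z = entry t' z) \<Longrightarrow> nbox t l = nbox t' l"
  unfolding nbox_def by (rule arg_cong[of _ _ card]) auto

lemma nbox_prefix: "prefix t t' \<Longrightarrow> l \<le> length t \<Longrightarrow> nbox t' l = nbox t l"
  by (rule nbox_cong) (simp add: entry_prefix)

lemma Sig_1_imp: "Sig 0 P \<Longrightarrow> Sig 1 Q \<Longrightarrow> Sig 1 (\<lambda>x. P x \<longrightarrow> Q x)"
  unfolding imp_conv_disj by (intro Sig_disj Sig_1_of_0[OF Sig_0_not])

lemma Sig_1_extends:
  assumes D: "Sig 1 (\<lambda>q. D (fst q) (fst (snd q)) (snd (snd q)))"
    and "rec_fun N" "rec_fun t" "rec_fun t'"
  shows "Sig 1 (\<lambda>x. extends (D x) (N x) (t x) (t' x))"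
proof -
  note r = assms(2-4) rec_fun_comp[OF assms(2), of fst]
    rec_fun_comp[OF assms(3), of fst] rec_fun_comp[OF assms(4), of fst]
  show ?thesis
    unfolding extends_def
    by (intro Sig_conj Sig_disj Sig_1_all_less Sig_1_imp Sig_1_of_0[OF Sig_0_eq]
        Sig_1_of_0[OF Sig_0_le] Sig_1_of_0[OF Sig_0_prefix] Sig_0_le
        Sig_subst_triple[of 1 D, OF D] rec_intros r)
qed

lemma extends_prefix: "extends D N t t' \<Longrightarrow> prefix t t'"
  by (simp add: extends_def)

lemma extends_length: "extends D N t t' \<Longrightarrow> length t \<le> length t'"
  by (simp add: extends_def prefix_length_le)

lemma extends_entry: "extends D N t t' \<Longrightarrow> length t \<le> z \<Longrightarrow> entry t' z = Suc v \<Longrightarrow> D z v"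
  unfolding extends_def by (cases "z < length t'") (force simp: entry_def)+

lemma extends_nbox: "extends D N t t' \<Longrightarrow> length t \<le> l \<Longrightarrow> l \<le> length t' \<Longrightarrow> N * nbox t' l \<le> l"
  by (simp add: extends_def)

lemma extendsI:
  assumes "prefix t t'"
    and "\<And>z v. length t \<le> z \<Longrightarrow> z < length t' \<Longrightarrow> entry t' z = Suc v \<Longrightarrow> D z v"
    and "\<And>l. length t \<le> l \<Longrightarrow> l \<le> length t' \<Longrightarrow> N * nbox t' l \<le> l"
  shows "extends D N t t'"
  unfolding extends_def
proof (intro conjI allI impI)
  fix z assume "z < length t'" "length t \<le> z"
  with assms(2)[of z "entry t' z - 1"] show "entry t' z = 0 \<or> D z (entry t' z - 1)"
    by (cases "entry t' z") auto
qed (use assms(1,3) in auto)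

lemma extends_mono:
  assumes "extends D N t t'" "\<And>z v. length t \<le> z \<Longrightarrow> D z v \<Longrightarrow> D' z v" "N' \<le> N"
  shows "extends D' N' t t'"
proof (rule extendsI)
  fix l assume "length t \<le> l" "l \<le> length t'"
  with assms(1) have "N * nbox t' l \<le> l" by (rule extends_nbox)
  moreover have "N' * nbox t' l \<le> N * nbox t' l" using assms(3) by simp
  ultimately show "N' * nbox t' l \<le> l" by linarith
qed (use assms extends_prefix extends_entry in \<open>blast+\<close>)

lemma extends_trans:
  assumes "extends D N t t'" "extends D N t' t''"
  shows "extends D N t t''"
proof (rule extendsI)
  have p: "prefix t t'" "prefix t' t''" using assms extends_prefix by auto
  then show "prefix t t''" by auto
  show "D z v" if "length t \<le> z" "z < length t''" "entry t'' z = Suc v" for z v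
    using that extends_entry[OF assms(1), of z v] extends_entry[OF assms(2), of z v]
      entry_prefix[OF p(2), of z] by (cases "z < length t'") auto
  show "N * nbox t'' l \<le> l" if "length t \<le> l" "l \<le> length t''" for l
    using that extends_nbox[OF assms(1), of l] extends_nbox[OF assms(2), of l]
      nbox_prefix[OF p(2), of l] by (cases "l \<le> length t'") auto
qed

lemma extends_trans_mono:
  assumes "extends D N t t'" "extends D' N' t' t''" "\<And>z v. D' z v \<Longrightarrow> D z v" "N \<le> N'"
  shows "extends D N t t''"
  using extends_trans[OF assms(1) extends_mono[OF assms(2) assms(3,4)]] .

text \<open>
  Neighbourhoods are closed under initial segments, since the bound on blanks holds at every length.
\<close>

lemma extends_take:
  assumes "extends D N t t''" "prefix t t'" "prefix t' t''"
  shows "extends D N t t'"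
proof (rule extendsI)
  have len: "length t' \<le> length t''" using assms(3) by (rule prefix_length_le)
  show "D z v" if "length t \<le> z" "z < length t'" "entry t' z = Suc v" for z v
    using that extends_entry[OF assms(1), of z v] entry_prefix[OF assms(3), of z] by simp
  show "N * nbox t' l \<le> l" if "length t \<le> l" "l \<le> length t'" for l
    using that extends_nbox[OF assms(1), of l] nbox_prefix[OF assms(3), of l] len by simp
qed (use assms in simp)

lemma extends_refl: "N * nbox t (length t) \<le> length t \<Longrightarrow> extends D N t t"
  by (rule extendsI) auto

lemma fits_extends: "fits k D N t \<Longrightarrow> length t \<le> n \<Longrightarrow> extends D N t (initial_segment k n)"
  by (simp add: fits_def)

lemma fits_trans:
  assumes "extends D N t t'" "fits k D' N' t'" "\<And>z v. D' z v \<Longrightarrow> D z v" "N \<le> N'"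
  shows "fits k D N t"
  unfolding fits_def
proof (intro allI impI)
  fix n assume n: "length t \<le> n"
  let ?m = "max n (length t')"
  have e: "extends D N t (initial_segment k ?m)"
    using extends_trans_mono[OF assms(1) fits_extends[OF assms(2)] assms(3,4)] by simp
  moreover have "prefix (initial_segment k n) (initial_segment k ?m)"
    by (rule prefix_initial_segment) simp
  moreover have "prefix t (initial_segment k n)"
    using extends_prefix[OF e] n by (auto simp: prefix_iff_entry entry_initial_segment)
  ultimately show "extends D N t (initial_segment k n)" using extends_take by blast
qed

lemma fits_entry: "fits k D N t \<Longrightarrow> z < length t \<Longrightarrow> k z = entry t z"
  using entry_prefix[OF extends_prefix[OF fits_extends[of k D N t "length t"]], of z]
  by (simp add: entry_initial_segment)

lemma nbox_initial_segment: "l \<le> n \<Longrightarrow> nbox (initial_segment k n) l = card ({z. k z = 0} \<inter> {..<l})"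
  unfolding nbox_def by (rule arg_cong[of _ _ card]) (auto simp: entry_initial_segment)

lemma density_zero_iff: "density_zero S \<longleftrightarrow> (\<forall>N. \<exists>L. \<forall>l\<ge>L. N * card (S \<inter> {..<l}) \<le> l)"
proof
  assume S: "density_zero S"
  show "\<forall>N. \<exists>L. \<forall>l\<ge>L. N * card (S \<inter> {..<l}) \<le> l"
  proof
    fix N
    have "(0::real) < 1 / real (Suc N)" by simp
    with S obtain L where L: "\<And>l. l \<ge> L \<Longrightarrow> \<bar>real (card (S \<inter> {..<l})) / real l\<bar> < 1 / real (Suc N)"
      unfolding density_zero_def LIMSEQ_iff by (metis diff_zero real_norm_def)
    have "N * card (S \<inter> {..<l}) \<le> l" if "l \<ge> Suc L" for l
    proof -
      have "real (card (S \<inter> {..<l})) / real l < 1 / real (Suc N)"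
        using L[of l] that by simp
      then have "real (Suc N) * real (card (S \<inter> {..<l})) < real l"
        using that by (simp add: field_simps)
      then have "Suc N * card (S \<inter> {..<l}) < l"
        by (simp only: of_nat_mult[symmetric] of_nat_less_iff)
      then show ?thesis by simp
    qed
    then show "\<exists>L. \<forall>l\<ge>L. N * card (S \<inter> {..<l}) \<le> l" by blast
  qed
next
  assume S: "\<forall>N. \<exists>L. \<forall>l\<ge>L. N * card (S \<inter> {..<l}) \<le> l"
  show "density_zero S"
    unfolding density_zero_def LIMSEQ_iff
  proof (intro allI impI)
    fix r :: real assume r: "r > 0"
    obtain N :: nat where N: "N > 0" "1 / real N < r"
      using ex_inverse_of_nat_less[OF r] by (auto simp: inverse_eq_divide)
    obtain L where L: "\<And>l. l \<ge> L \<Longrightarrow> N * card (S \<inter> {..<l}) \<le> l"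
      using S by blast
    have "norm (real (card (S \<inter> {..<l})) / real l - 0) < r" if "l \<ge> Suc L" for l
    proof -
      have "real N * real (card (S \<inter> {..<l})) \<le> real l"
        using L[of l] that by (simp only: of_nat_mult[symmetric] of_nat_le_iff)
      then have "real (card (S \<inter> {..<l})) / real l \<le> 1 / real N"
        using that N by (simp add: field_simps)
      then show ?thesis using N by simp
    qed
    then show "\<exists>no. \<forall>n\<ge>no. norm (real (card (S \<inter> {..<n})) / real n - 0) < r" by blast
  qed
qed

lemma ex_dependent_sequence:
  assumes "P a" "\<And>s i. P s \<Longrightarrow> \<exists>s'. P s' \<and> R i s s'"
  shows "\<exists>s. s 0 = a \<and> (\<forall>n. P (s n) \<and> R n (s n) (s (Suc n)))"
  using dependent_nat_choice[of "\<lambda>n s. P s \<and> (n = 0 \<longrightarrow> s = a)" R] assms by auto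

text \<open>
  A Baire category argument: any countable list of requirements, each of which can be met by passing
  to a stronger condition, is met by one description. The growth hypothesis makes its set of blanks
  have density \<open>0\<close>.
\<close>

lemma generic_description:
  fixes Q :: "nat list \<Rightarrow> nat \<Rightarrow> (nat \<Rightarrow> nat \<Rightarrow> bool) \<Rightarrow> bool"
    and Good :: "nat \<Rightarrow> nat list \<Rightarrow> nat \<Rightarrow> (nat \<Rightarrow> nat \<Rightarrow> bool) \<Rightarrow> bool"
  assumes start: "Q t0 N0 D0"
    and step: "\<And>t N D i. Q t N D \<Longrightarrow> \<exists>t' N' D'. Q t' N' D' \<and> extends D N t t' \<and> N \<le> N' \<and>
      (\<forall>z v. D' z v \<longrightarrow> D z v) \<and> Good i t' N' D'"
    and grow: "\<And>t N D i. Q t N D \<Longrightarrow> \<exists>t' N'. Q t' N' D \<and> extends D N t t' \<and> N \<le> N' \<and>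
      i \<le> N' \<and> i \<le> length t'"
  obtains k where "fits k D0 N0 t0" "density_zero {z. k z = 0}"
    "\<And>i. \<exists>t N D. Q t N D \<and> Good i t N D \<and> fits k D N t"
proof -
  let ?P = "\<lambda>(t, N, D). Q t N D"
  let ?R = "\<lambda>i (t, N, D) (t', N', D'). extends D N t t' \<and> N \<le> N' \<and> (\<forall>z v. D' z v \<longrightarrow> D z v) \<and>
    i \<le> N' \<and> i \<le> length t' \<and> Good i t' N' D'"
  have next_condition: "\<exists>s'. ?P s' \<and> ?R i s s'" if "?P s" for s i
  proof -
    obtain t N D where s: "s = (t, N, D)" by (cases s)
    with that grow[of t N D i] obtain t1 N1 where
      1: "Q t1 N1 D" "extends D N t t1" "N \<le> N1" "i \<le> N1" "i \<le> length t1" by auto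
    from step[OF 1(1), of i] obtain t2 N2 D2 where
      2: "Q t2 N2 D2" "extends D N1 t1 t2" "N1 \<le> N2" "\<forall>z v. D2 z v \<longrightarrow> D z v" "Good i t2 N2 D2"
      by blast
    have "extends D N t t2" using extends_trans_mono[OF 1(2) 2(2)] 1(3) by blast
    with 1 2 extends_length[OF 2(2)] s show ?thesis
      by (intro exI[of _ "(t2, N2, D2)"]) auto
  qed
  have "\<exists>s. s 0 = (t0, N0, D0) \<and> (\<forall>n. ?P (s n) \<and> ?R n (s n) (s (Suc n)))"
    by (rule ex_dependent_sequence[where P = ?P and R = ?R, OF _ next_condition]) (simp_all add: start)
  then obtain s where s0: "s 0 = (t0, N0, D0)" and PR: "\<forall>n. ?P (s n) \<and> ?R n (s n) (s (Suc n))"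
    by (elim exE conjE)
  note P = PR[rule_format, THEN conjunct1] and R = PR[rule_format, THEN conjunct2]
  define t N D where "t = (\<lambda>n. fst (s n))" and "N = (\<lambda>n. fst (snd (s n)))" and "D = (\<lambda>n. snd (snd (s n)))"
  have s: "s n = (t n, N n, D n)" for n by (simp add: t_def N_def D_def)
  have Q: "Q (t n) (N n) (D n)" for n using P[of n] by (simp add: s)
  have suc: "extends (D n) (N n) (t n) (t (Suc n))" "N n \<le> N (Suc n)" "\<And>z v. D (Suc n) z v \<Longrightarrow> D n z v"
    "n \<le> N (Suc n)" "n \<le> length (t (Suc n))" "Good n (t (Suc n)) (N (Suc n)) (D (Suc n))" for n
    using R[of n] by (auto simp: s)
  have le: "N n \<le> N (n + j) \<and> (\<forall>z v. D (n + j) z v \<longrightarrow> D n z v) \<and> extends (D n) (N n) (t n) (t (Suc (n + j)))" for n j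
  proof (induction j)
    case 0
    then show ?case using suc by simp
  next
    case (Suc j)
    have "extends (D n) (N n) (t n) (t (Suc (Suc (n + j))))"
      using extends_trans_mono[of "D n" "N n" "t n" "t (Suc (n + j))", OF _ suc(1)] Suc suc(2,3)[of "n + j"]
      by (meson le_trans)
    with Suc suc(2,3)[of "n + j"] show ?case by (auto intro: le_trans)
  qed
  define k where "k z = entry (t (Suc (Suc z))) z" for z
  have k: "k z = entry (t n) z" if "z < length (t n)" for z n
  proof -
    have pre: "prefix (t m) (t (Suc (m + j)))" for m j using le extends_prefix by blast
    have z: "z < length (t (Suc (Suc z)))" using suc(5)[of "Suc z"] by simp
    consider "n = Suc (Suc z)" | j where "n = Suc (Suc (Suc z) + j)" | j where "Suc (Suc z) = Suc (n + j)"
      by (metis less_imp_Suc_add linorder_neqE_nat)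
    then show ?thesis
      using entry_prefix[OF pre, of z] z that unfolding k_def by cases metis+
  qed
  have fits: "fits k (D n) (N n) (t n)" for n
    unfolding fits_def
  proof (intro allI impI)
    fix m assume m: "length (t n) \<le> m"
    let ?t = "t (Suc (n + m))"
    have e: "extends (D n) (N n) (t n) ?t" using le by blast
    have "m \<le> length ?t" using suc(5)[of "n + m"] by simp
    then have "prefix (initial_segment k m) ?t"
      using k[of _ "Suc (n + m)"] by (auto simp: prefix_iff_entry entry_initial_segment)
    moreover have "prefix (t n) (initial_segment k m)"
      using m k[of _ n] by (auto simp: prefix_iff_entry entry_initial_segment)
    ultimately show "extends (D n) (N n) (t n) (initial_segment k m)"
      using extends_take[OF e] by blast
  qed
  have "fits k D0 N0 t0" using fits[of 0] s[of 0] s0 by simp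
  moreover have "density_zero {z. k z = 0}"
    unfolding density_zero_iff
  proof (intro allI exI impI)
    fix M l assume l: "length (t (Suc M)) \<le> l"
    have "N (Suc M) * nbox (initial_segment k l) l \<le> l"
      using extends_nbox[OF fits_extends[OF fits l] l] by simp
    moreover have "M * nbox (initial_segment k l) l \<le> N (Suc M) * nbox (initial_segment k l) l"
      by (rule mult_le_mono1) (rule suc(4))
    ultimately have "M * nbox (initial_segment k l) l \<le> l" by (rule order_trans[rotated])
    then show "M * card ({z. k z = 0} \<inter> {..<l}) \<le> l"
      by (simp add: nbox_initial_segment)
  qed
  moreover have "\<exists>t N D. Q t N D \<and> Good i t N D \<and> fits k D N t" for i
    using Q suc(6) fits by blast
  ultimately show ?thesis using that by blast
qed

subsection \<open>Completing a string where values are known\<close>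

definition undef :: "(nat \<Rightarrow> nat \<Rightarrow> bool) \<Rightarrow> nat set" where
  "undef D = {z. \<forall>v. \<not> D z v}"

definition sparse_from :: "(nat \<Rightarrow> nat \<Rightarrow> bool) \<Rightarrow> nat \<Rightarrow> nat \<Rightarrow> bool" where
  "sparse_from D N L \<longleftrightarrow> (\<forall>l\<ge>L. N * card (undef D \<inter> {L..<l}) \<le> l)"

lemma density_zero_sparse_from:
  assumes "density_zero (undef D)"
  obtains L0 where "\<And>L. L0 \<le> L \<Longrightarrow> sparse_from D N L"
proof -
  obtain L0 where L0: "\<And>l. l \<ge> L0 \<Longrightarrow> N * card (undef D \<inter> {..<l}) \<le> l"
    using assms unfolding density_zero_iff by blast
  have "sparse_from D N L" if "L0 \<le> L" for L
    unfolding sparse_from_def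
  proof (intro allI impI)
    fix l assume "L \<le> l"
    have "card (undef D \<inter> {L..<l}) \<le> card (undef D \<inter> {..<l})" by (rule card_mono) auto
    then have "N * card (undef D \<inter> {L..<l}) \<le> N * card (undef D \<inter> {..<l})" by simp
    with L0[of l] \<open>L \<le> l\<close> that show "N * card (undef D \<inter> {L..<l}) \<le> l" by linarith
  qed
  then show ?thesis using that by blast
qed

definition complete :: "(nat \<Rightarrow> nat \<Rightarrow> bool) \<Rightarrow> nat list \<Rightarrow> nat \<Rightarrow> nat list" where
  "complete D t l = map (\<lambda>z. if z < length t then entry t z
     else if z \<in> undef D then 0 else Suc (SOME v. D z v)) [0..<l]"

lemma length_complete [simp]: "length (complete D t l) = l"
  by (simp add: complete_def)

lemma entry_complete: "z < l \<Longrightarrow> entry (complete D t l) z = (if z < length t then entry t z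
     else if z \<in> undef D then 0 else Suc (SOME v. D z v))"
  by (simp add: complete_def entry_def)

lemma prefix_complete: "length t \<le> l \<Longrightarrow> prefix t (complete D t l)"
  by (simp add: prefix_iff_entry entry_complete)

lemma nbox_complete:
  assumes "length t \<le> l'" "l' \<le> l"
  shows "nbox (complete D t l) l' = nbox t (length t) + card (undef D \<inter> {length t..<l'})"
proof -
  have "{z. z < l' \<and> entry (complete D t l) z = 0} =
      {z. z < length t \<and> entry t z = 0} \<union> undef D \<inter> {length t..<l'}"
    using assms by (auto simp: entry_complete split: if_splits)
  moreover have "card ({z. z < length t \<and> entry t z = 0} \<union> undef D \<inter> {length t..<l'}) =
      card {z. z < length t \<and> entry t z = 0} + card (undef D \<inter> {length t..<l'})"
    by (rule card_Un_disjoint) auto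
  ultimately show ?thesis by (simp add: nbox_def)
qed

lemma extends_complete:
  assumes "length t \<le> l"
    and "\<And>l'. length t \<le> l' \<Longrightarrow> l' \<le> l \<Longrightarrow> N * (nbox t (length t) + card (undef D \<inter> {length t..<l'})) \<le> l'"
  shows "extends D N t (complete D t l)"
proof (rule extendsI)
  show "D z v" if "length t \<le> z" "z < length (complete D t l)" "entry (complete D t l) z = Suc v" for z v
  proof -
    have z: "z \<notin> undef D" "v = (SOME v. D z v)"
      using that by (auto simp: entry_complete split: if_splits)
    then obtain v' where "D z v'" by (auto simp: undef_def)
    then show ?thesis unfolding z(2) by (rule someI)
  qed
qed (use assms in \<open>simp_all add: prefix_complete nbox_complete\<close>)

text \<open>
  If what is known beyond \<open>t\<close> has twice the required density, then \<open>t\<close> can be continued within the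
  bound until an arbitrarily good density is reached, and is kept by what is known from then on. The
  factor \<open>2\<close> is shared between the blanks inherited from \<open>t\<close> and those that are added.
\<close>

lemma grow_string:
  assumes "2 * M * nbox t (length t) \<le> length t" "sparse_from D (2 * M) (length t)"
    and dens: "density_zero (undef D)"
  obtains t' where "extends D M t t'" "i \<le> length t'" "M' * nbox t' (length t') \<le> length t'"
    "sparse_from D M' (length t')"
proof -
  obtain L1 where L1: "\<And>L. L1 \<le> L \<Longrightarrow> sparse_from D M' L"
    using density_zero_sparse_from[OF dens, of M'] by blast
  obtain L2 where L2: "\<And>l. l \<ge> L2 \<Longrightarrow> 2 * M' * card (undef D \<inter> {..<l}) \<le> l"
    using dens unfolding density_zero_iff by blast
  define l where "l = length t + i + L1 + L2 + 2 * M' * length t"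
  have "extends D M t (complete D t l)"
  proof (rule extends_complete)
    fix l' assume "length t \<le> l'" "l' \<le> l"
    then have "2 * M * card (undef D \<inter> {length t..<l'}) \<le> l'"
      using assms(2) by (simp add: sparse_from_def)
    with assms(1) \<open>length t \<le> l'\<close> show "M * (nbox t (length t) + card (undef D \<inter> {length t..<l'})) \<le> l'"
      by (simp add: algebra_simps)
  qed (simp add: l_def)
  moreover have "i \<le> length (complete D t l)" by (simp add: l_def)
  moreover have "M' * nbox (complete D t l) l \<le> l"
  proof -
    have "nbox t (length t) \<le> card {..<length t}"
      unfolding nbox_def by (rule card_mono) auto
    moreover have "card (undef D \<inter> {length t..<l}) \<le> card (undef D \<inter> {..<l})"
      by (rule card_mono) auto
    ultimately have "nbox (complete D t l) l \<le> length t + card (undef D \<inter> {..<l})"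
      by (simp add: nbox_complete l_def)
    then have "2 * M' * nbox (complete D t l) l \<le> 2 * M' * (length t + card (undef D \<inter> {..<l}))"
      by (rule mult_le_mono2)
    moreover have "2 * M' * card (undef D \<inter> {..<l}) \<le> l" by (rule L2) (simp add: l_def)
    moreover have "2 * M' * length t \<le> l" by (simp add: l_def)
    ultimately show ?thesis by (simp add: algebra_simps)
  qed
  moreover have "sparse_from D M' l" by (rule L1) (simp add: l_def)
  ultimately show ?thesis using that[of "complete D t l"] by simp
qed

text \<open>
  Sparseness beyond \<open>L\<close> is witnessed by finite strings that carry no blank below \<open>L\<close>; this is the form
  in which it can be forced.
\<close>

lemma sparse_from_imp_extends:
  assumes "sparse_from D N L" "L \<le> l"
  shows "\<exists>t. length t = l \<and> extends D N (replicate L 1) t"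
proof -
  have "nbox (replicate L 1) L = 0" by (simp add: nbox_def entry_def)
  then have "extends D N (replicate L 1) (complete D (replicate L 1) l)"
    using assms by (intro extends_complete) (simp_all add: sparse_from_def)
  then show ?thesis by (intro exI[of _ "complete D (replicate L 1) l"]) simp
qed

lemma extends_imp_sparse_from:
  assumes "\<And>l. L \<le> l \<Longrightarrow> \<exists>t. length t = l \<and> extends D N (replicate L 1) t"
  shows "sparse_from D N L"
  unfolding sparse_from_def
proof (intro allI impI)
  fix l assume l: "L \<le> l"
  then obtain t where t: "length t = l" "extends D N (replicate L 1) t" using assms by blast
  have "entry t z = 0" if "z \<in> undef D" "L \<le> z" for z
    using extends_entry[OF t(2), of z "entry t z - 1"] that by (cases "entry t z") (auto simp: undef_def)
  then have "card (undef D \<inter> {L..<l}) \<le> nbox t l"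
    unfolding nbox_def by (intro card_mono) auto
  then have "N * card (undef D \<inter> {L..<l}) \<le> N * nbox t l" by simp
  also have "\<dots> \<le> l" using extends_nbox[OF t(2), of l] t(1) l by simp
  finally show "N * card (undef D \<inter> {L..<l}) \<le> l" .
qed

text \<open>
  A string found with no regard to \<open>s\<close> can replace the part beyond \<open>s\<close>; the blanks of both add up,
  which again costs a factor of \<open>2\<close>.
\<close>

lemma extends_combine:
  assumes "extends D (2 * M) (replicate (length s) 1) t" "2 * M * nbox s (length s) \<le> length s"
  shows "extends D M s (s @ drop (length s) t)"
proof (rule extendsI)
  let ?t = "s @ drop (length s) t"
  have len: "length s \<le> length t" using extends_length[OF assms(1)] by simp
  have e: "entry ?t z = (if z < length s then entry s z else entry t z)" for z
    using len by (auto simp: entry_def nth_append)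
  show "D z v" if "length s \<le> z" "z < length ?t" "entry ?t z = Suc v" for z v
    using that extends_entry[OF assms(1), of z v] by (simp add: e)
  show "M * nbox ?t l \<le> l" if "length s \<le> l" "l \<le> length ?t" for l
  proof -
    have "nbox ?t l \<le> card ({z. z < length s \<and> entry s z = 0} \<union> {z. z < l \<and> entry t z = 0})"
      unfolding nbox_def by (rule card_mono) (auto simp: e)
    also have "\<dots> \<le> nbox s (length s) + nbox t l"
      unfolding nbox_def by (rule card_Un_le)
    finally have "2 * M * nbox ?t l \<le> 2 * M * (nbox s (length s) + nbox t l)"
      by (rule mult_le_mono2)
    moreover have "2 * M * nbox t l \<le> l"
      using extends_nbox[OF assms(1), of l] that len by simp
    ultimately show ?thesis using assms(2) that by (simp add: algebra_simps)
  qed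
qed simp

section \<open>A reduction that works throughout a neighbourhood\<close>

definition graph :: "(nat \<Rightarrow> nat) \<Rightarrow> nat \<Rightarrow> nat \<Rightarrow> bool" where
  "graph f z v \<longleftrightarrow> f z = v"

definition string_graph :: "nat list \<Rightarrow> nat \<Rightarrow> nat \<Rightarrow> bool" where
  "string_graph \<tau> z v \<longleftrightarrow> z < length \<tau> \<and> entry \<tau> z = v"

definition description :: "(nat \<Rightarrow> nat) \<Rightarrow> nat \<Rightarrow> nat option" where
  "description k z = (if k z = 0 then None else Some (k z - 1))"

lemma code_box_description: "code_box (description k) = k"
  by (auto simp: code_box_def description_def fun_eq_iff)

lemma effective_dense_descriptionI:
  assumes "density_zero {z. k z = 0}" "\<And>z v. k z = Suc v \<Longrightarrow> f z = v"
  shows "effective_dense_description f (description k)"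
proof -
  have "description k z = Some (f z) \<or> description k z = None" for z
    using assms(2)[of z "k z - 1"] by (cases "k z") (auto simp: description_def)
  moreover have "{z. description k z = None} = {z. k z = 0}"
    by (auto simp: description_def)
  ultimately show ?thesis using assms(1) by (simp add: effective_dense_description_def)
qed

lemma fits_value: "fits k D N t \<Longrightarrow> length t \<le> z \<Longrightarrow> k z = Suc v \<Longrightarrow> D z v"
  using extends_entry[OF fits_extends[of k D N t "Suc z"], of z v]
  by (simp add: entry_initial_segment)

definition computes :: "prog \<Rightarrow> (nat \<Rightarrow> nat) \<Rightarrow> (nat \<Rightarrow> nat option) \<Rightarrow> bool" where
  "computes p k g \<longleftrightarrow> (\<forall>z v. code_box g z = v \<longleftrightarrow> (\<exists>n. ev p (initial_segment k n) z v))"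

text \<open>
  Descriptions enter as functions to \<^typ>\<open>nat\<close> with \<open>0\<close> for blanks, which is how they are queried.
\<close>

lemma NED_ge_computes:
  assumes "f \<ge>\<^sub>N\<^sub>E\<^sub>D x" "density_zero {z. k z = 0}" "\<And>z v. k z = Suc v \<Longrightarrow> f z = v"
  obtains p g where "effective_dense_description x g" "computes p k g"
proof -
  have "effective_dense_description f (description k)"
    using assms(2,3) by (rule effective_dense_descriptionI)
  then obtain g where "effective_dense_description x g" "code_box g \<le>\<^sub>T k"
    using assms(1) unfolding NED_ge_def by (metis code_box_description)
  then show ?thesis using that unfolding computes_def by (metis turing_le_imp_prog)
qed

lemma undef_graph: "undef (graph f) = {}"
  by (simp add: undef_def graph_def)

text \<open>
  Descriptions of a total function can be continued without any blank, so here no factor is lost.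
\<close>

lemma pad_string:
  assumes "M * nbox t (length t) \<le> length t"
  obtains t' where "extends (graph f) M t t'" "i \<le> length t'" "M' * nbox t' (length t') \<le> length t'"
proof -
  define l where "l = length t + i + M' * nbox t (length t)"
  have "extends (graph f) M t (complete (graph f) t l)"
    by (rule extends_complete) (use assms in \<open>simp_all add: l_def undef_graph\<close>)
  moreover have "M' * nbox (complete (graph f) t l) l \<le> l"
    by (subst nbox_complete) (simp_all add: l_def undef_graph)
  ultimately show ?thesis using that[of "complete (graph f) t l"] by (simp add: l_def)
qed

text \<open>
  One functional works on a whole neighbourhood: otherwise every functional could be defeated by
  passing to a smaller neighbourhood, and a description in all of them would compute nothing.
\<close>

lemma NED_ge_uniform:
  assumes "f \<ge>\<^sub>N\<^sub>E\<^sub>D x"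
  shows "\<exists>p u0 E. E * nbox u0 (length u0) \<le> length u0 \<and> (\<forall>u. extends (graph f) E u0 u \<longrightarrow>
      (\<exists>k g. fits k (graph f) E u \<and> effective_dense_description x g \<and> computes p k g))"
proof (rule ccontr)
  assume no: "\<not> ?thesis"
  define ok where "ok p k \<longleftrightarrow> (\<exists>g. effective_dense_description x g \<and> computes p k g)" for p k
  have bad: "\<exists>u. extends (graph f) E u0 u \<and> (\<forall>k. fits k (graph f) E u \<longrightarrow> \<not> ok p k)"
    if "E * nbox u0 (length u0) \<le> length u0" for p u0 E
    using no that unfolding ok_def by blast
  define Q where "Q t N D \<longleftrightarrow> D = graph f \<and> 2 * N * nbox t (length t) \<le> length t" for t N D
  define Good where "Good i t N D \<longleftrightarrow> (\<forall>k. fits k D N t \<longrightarrow> \<not> ok (from_nat i) k)" for i :: nat and t N D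
  obtain k where k: "fits k (graph f) 1 []" "density_zero {z. k z = 0}"
    "\<And>i. \<exists>t N D. Q t N D \<and> Good i t N D \<and> fits k D N t"
  proof (rule generic_description[of Q "[]" 1 "graph f" Good])
    show "Q [] 1 (graph f)" by (simp add: Q_def nbox_def)
  next
    fix t N D i
    assume Q: "Q t N D"
    then obtain u where u: "extends (graph f) (2 * N) t u"
        "\<forall>k. fits k (graph f) (2 * N) u \<longrightarrow> \<not> ok (from_nat i) k"
      using bad[of "2 * N" t "from_nat i"] by (auto simp: Q_def)
    have "2 * N * nbox u (length u) \<le> length u"
      using extends_nbox[OF u(1)] extends_length[OF u(1)] by blast
    from pad_string[OF this, of f 0 "2 * (2 * N)"] obtain t' where
      t': "extends (graph f) (2 * N) u t'" "2 * (2 * N) * nbox t' (length t') \<le> length t'"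
      by blast
    have "Good i t' (2 * N) (graph f)"
      unfolding Good_def using u(2) fits_trans[OF t'(1)] by blast
    moreover have "extends (graph f) N t t'"
      by (rule extends_mono[OF extends_trans[OF u(1) t'(1)]]) simp_all
    ultimately show "\<exists>t' N' D'. Q t' N' D' \<and> extends D N t t' \<and> N \<le> N' \<and>
        (\<forall>z v. D' z v \<longrightarrow> D z v) \<and> Good i t' N' D'"
      using Q t'(2) unfolding Q_def
      by (intro exI[of _ t'] exI[of _ "2 * N"] exI[of _ "graph f"]) simp
  next
    fix t N D i
    assume Q: "Q t N D"
    then have "N * nbox t (length t) \<le> length t" by (simp add: Q_def)
    from pad_string[OF this, of f i "2 * (N + i)"] obtain t' where
      t': "extends (graph f) N t t'" "i \<le> length t'" "2 * (N + i) * nbox t' (length t') \<le> length t'"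
      by blast
    then show "\<exists>t' N'. Q t' N' D \<and> extends D N t t' \<and> N \<le> N' \<and> i \<le> N' \<and> i \<le> length t'"
      using Q unfolding Q_def by (intro exI[of _ t'] exI[of _ "N + i"]) simp
  qed blast
  have val: "f z = v" if "k z = Suc v" for z v
    using fits_value[OF k(1), of z v] that by (simp add: graph_def)
  obtain p g where "effective_dense_description x g" "computes p k g"
    by (rule NED_ge_computes[OF assms k(2) val])
  then have "ok p k" unfolding ok_def by blast
  moreover have "\<not> ok (from_nat (to_nat p)) k"
    using k(3)[of "to_nat p"] unfolding Good_def by blast
  ultimately show False by simp
qed

text \<open>
  The values that \<open>p\<close> computes from descriptions extending \<open>u\<close> with values in \<open>D\<close>. For \<open>D\<close> the graph
  of a string this is a \<open>\<Sigma>\<^sub>1\<close> relation, which makes it accessible to genericity.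
\<close>

definition outputs :: "prog \<Rightarrow> nat \<Rightarrow> (nat \<Rightarrow> nat \<Rightarrow> bool) \<Rightarrow> nat list \<Rightarrow> nat \<Rightarrow> nat \<Rightarrow> bool" where
  "outputs p E D u z v \<longleftrightarrow> (\<exists>w. extends D E u w \<and> ev p w z (Suc v))"

lemma outputs_mono:
  assumes "outputs p E D u z v" "\<And>z v. length u \<le> z \<Longrightarrow> D z v \<Longrightarrow> D' z v"
  shows "outputs p E D' u z v"
  using assms extends_mono[of D E u _ D' E] unfolding outputs_def by blast

lemma outputs_extends:
  assumes "outputs p E D u' z v" "extends D E u u'"
  shows "outputs p E D u z v"
  using assms extends_trans unfolding outputs_def by blast

lemma extends_outputs_mono:
  assumes "extends (outputs p E D u) N t t'" "\<And>z v. length u \<le> z \<Longrightarrow> D z v \<Longrightarrow> D' z v"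
  shows "extends (outputs p E D' u) N t t'"
  by (rule extends_mono[OF assms(1) _ le_refl]) (rule outputs_mono, assumption, rule assms(2))

lemma string_graph_initial_segment: "string_graph (initial_segment f n) z v \<longleftrightarrow> z < n \<and> f z = v"
  by (auto simp: string_graph_def entry_initial_segment)

lemma string_graph_prefix: "prefix \<tau> \<tau>' \<Longrightarrow> string_graph \<tau> z v \<Longrightarrow> string_graph \<tau>' z v"
  by (auto simp: string_graph_def prefix_iff_entry)

lemma extends_outputs_prefix:
  "extends (outputs p E (string_graph \<tau>) u) N t t' \<Longrightarrow> prefix \<tau> \<tau>' \<Longrightarrow>
    extends (outputs p E (string_graph \<tau>') u) N t t'"
  using extends_outputs_mono[of p E "string_graph \<tau>" u N t t' "string_graph \<tau>'"] string_graph_prefix by blast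

text \<open>
  An output depends on finitely many values of the function, and so do the finitely many outputs
  recorded in a string; this is what lets strings decide facts about \<open>f\<close>.
\<close>

lemma outputs_initial_segment:
  assumes "outputs p E (graph f) u z v"
  shows "\<exists>n. outputs p E (string_graph (initial_segment f n)) u z v"
proof -
  obtain w where w: "extends (graph f) E u w" "ev p w z (Suc v)"
    using assms by (auto simp: outputs_def)
  have "extends (string_graph (initial_segment f (length w))) E u w"
  proof (rule extendsI)
    fix y b assume "length u \<le> y" "y < length w" "entry w y = Suc b"
    with extends_entry[OF w(1)] show "string_graph (initial_segment f (length w)) y b"
      by (simp add: string_graph_initial_segment graph_def)
  qed (use w(1) extends_prefix extends_nbox in blast)+
  with w(2) show ?thesis unfolding outputs_def by blast
qed

lemma extends_outputs_initial_segment: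
  assumes "extends (outputs p E (graph f) u) N t t'"
  shows "\<exists>n. \<forall>m\<ge>n. extends (outputs p E (string_graph (initial_segment f m)) u) N t t'"
proof -
  let ?D = "\<lambda>n. outputs p E (string_graph (initial_segment f n)) u"
  have mono: "?D n z v \<Longrightarrow> n \<le> m \<Longrightarrow> ?D m z v" for n m z v
    by (erule outputs_mono) (simp add: string_graph_initial_segment)
  have "\<exists>n. length t \<le> z \<longrightarrow> (\<forall>v. entry t' z = Suc v \<longrightarrow> ?D n z v)" if "z < length t'" for z
    using outputs_initial_segment[of p E f u z "entry t' z - 1"]
      extends_entry[OF assms, of z "entry t' z - 1"] by (cases "entry t' z") auto
  then obtain n where n: "\<forall>z<length t'. length t \<le> z \<longrightarrow> (\<forall>v. entry t' z = Suc v \<longrightarrow> ?D n z v)"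
    using all_less_ex_common_bound[of "length t'"
        "\<lambda>z n. length t \<le> z \<longrightarrow> (\<forall>v. entry t' z = Suc v \<longrightarrow> ?D n z v)"] mono by blast
  have "extends (?D m) N t t'" if "n \<le> m" for m
  proof (rule extendsI)
    show "?D m z v" if "length t \<le> z" "z < length t'" "entry t' z = Suc v" for z v
      using n that mono \<open>n \<le> m\<close> by blast
  qed (use assms extends_prefix extends_nbox in blast)+
  then show ?thesis by blast
qed

lemma rec_fun_replicate [rec_intros]:
  assumes "rec_fun n" shows "rec_fun (\<lambda>x. replicate (n x) (1::nat))"
proof -
  have "enc (1 # xs :: nat list) = Suc (prod_encode (1, enc xs))" for xs
    by (simp add: enc_nat_list)
  then have cons: "rec_fun (\<lambda>xs :: nat list. (1::nat) # xs)"
    using rec_fun_Suc[OF rec_fun_prod_encode[OF rec_fun_Pair[OF rec_fun_const[of "1::nat"]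
        rec_fun_enc[OF rec_fun_id]]]]
    by (simp add: rec_fun_def enc_nat_def)
  have "rec_fun (\<lambda>x. rec_nat [] (\<lambda>_ ys. (1::nat) # ys) (n x))"
    by (intro rec_intros assms rec_fun_comp[OF cons])
  moreover have "rec_nat [] (\<lambda>_ ys. (1::nat) # ys) k = replicate k 1" for k
    by (induction k) auto
  ultimately show ?thesis by simp
qed

lemma Sig_1_outputs:
  assumes "rec_fun \<tau>" "rec_fun u" "rec_fun z" "rec_fun v"
  shows "Sig 1 (\<lambda>x. outputs p E (string_graph (\<tau> x)) (u x) (z x) (v x))"
proof -
  note r = assms assms[THEN rec_fun_comp, of fst] assms[THEN rec_fun_comp, of "\<lambda>q. fst (fst q)"]
  show ?thesis
    unfolding outputs_def string_graph_def
    by (intro Sig_1_ex Sig_conj Sig_1_extends Sig_1_ev Sig_1_of_0[OF Sig_0_less]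
        Sig_1_of_0[OF Sig_0_eq] rec_intros r)
qed

lemma Sig_1_extends_outputs:
  assumes "rec_fun \<tau>" "rec_fun u" "rec_fun N" "rec_fun t" "rec_fun t'"
  shows "Sig 1 (\<lambda>x. extends (outputs p E (string_graph (\<tau> x)) (u x)) (N x) (t x) (t' x))"
  by (intro Sig_1_extends Sig_1_outputs rec_intros assms
      rec_fun_comp[OF assms(1), of fst] rec_fun_comp[OF assms(2), of fst])

section \<open>Forcing with initial segments of a generic function\<close>

lemma Sig_1_imp_2: "Sig 1 P \<Longrightarrow> Sig 2 P"
  using Sig_Suc_mono[of 1] by (simp add: numeral_2_eq_2)

lemma Sig_2_imp_3: "Sig 2 P \<Longrightarrow> Sig 3 P"
  using Sig_Suc_mono[of 2] by (simp add: numeral_3_eq_3 numeral_2_eq_2)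

lemma Sig_0_imp_3: "Sig 0 P \<Longrightarrow> Sig 3 P"
  by (intro Sig_2_imp_3 Sig_1_imp_2 Sig_1_of_0)

lemma Sig_1_imp_3: "Sig 1 P \<Longrightarrow> Sig 3 P"
  by (intro Sig_2_imp_3 Sig_1_imp_2)

lemma Sig_2_ex: "Sig 2 (\<lambda>q. P (fst q) (snd q)) \<Longrightarrow> Sig 2 (\<lambda>x. \<exists>y::'b::coded. P x y)"
  using Sig_ex[of 1] by (simp add: numeral_2_eq_2)

lemma Sig_3_ex: "Sig 3 (\<lambda>q. P (fst q) (snd q)) \<Longrightarrow> Sig 3 (\<lambda>x. \<exists>y::'b::coded. P x y)"
  using Sig_ex[of 2] by (simp add: numeral_3_eq_3 numeral_2_eq_2)

lemma Sig_2_not: "Sig 1 P \<Longrightarrow> Sig 2 (\<lambda>x. \<not> P x)"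
  using Sig_not_Suc[of 1 "\<lambda>x. \<not> P x"] by (simp add: numeral_2_eq_2)

lemma Sig_3_not: "Sig 2 (\<lambda>x. \<not> P x) \<Longrightarrow> Sig 3 P"
  using Sig_not_Suc[of 2 P] by (simp add: numeral_3_eq_3 numeral_2_eq_2)

lemma generic_avoid:
  assumes "generic 3 f" "Sig 3 W" "\<And>k. \<not> W (initial_segment f k)"
  obtains j where "\<And>\<tau>. prefix (initial_segment f j) \<tau> \<Longrightarrow> \<not> W \<tau>"
proof -
  have "Sigma0_strings 3 {\<tau>. W \<tau>}" using assms(2) by (simp add: Sigma0_strings_iff_Sig)
  with assms(1,3) obtain j where "\<not> (\<exists>\<tau>\<in>{\<tau>. W \<tau>}. prefix (initial_segment f j) \<tau>)"
    unfolding generic_def by blast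
  then show ?thesis using that by blast
qed

lemma generic_meet:
  assumes "generic 3 f" "Sig 3 W" "\<And>j. \<exists>\<tau>. prefix (initial_segment f j) \<tau> \<and> W \<tau>"
  obtains k where "W (initial_segment f k)"
  using generic_avoid[OF assms(1,2)] assms(3) by metis

text \<open>
  \<open>forces_sparse\<close> is density above \<open>\<tau>\<close> of the strings that witness sparseness up to \<open>l\<close>, for each \<open>l\<close>.
  For a generic function it agrees with the truth, as \<open>sparse_imp_forced\<close> and \<open>forced_imp_sparse\<close> say.
\<close>

definition sparse_above :: "prog \<Rightarrow> nat \<Rightarrow> nat list \<Rightarrow> nat \<Rightarrow> nat \<Rightarrow> nat \<Rightarrow> nat list \<Rightarrow> bool" where
  "sparse_above p E u N L l \<tau> \<longleftrightarrow> (\<exists>\<tau>' t. prefix \<tau> \<tau>' \<and> length t = l \<and>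
     extends (outputs p E (string_graph \<tau>') u) N (replicate L 1) t)"

definition forces_sparse :: "prog \<Rightarrow> nat \<Rightarrow> nat list \<Rightarrow> nat \<Rightarrow> nat \<Rightarrow> nat list \<Rightarrow> bool" where
  "forces_sparse p E u N L \<tau> \<longleftrightarrow>
     (\<forall>\<tau>' l. prefix \<tau> \<tau>' \<longrightarrow> L \<le> l \<longrightarrow> sparse_above p E u N L l \<tau>')"

lemma Sig_1_sparse_above:
  assumes "rec_fun u" "rec_fun N" "rec_fun L" "rec_fun l" "rec_fun \<tau>"
  shows "Sig 1 (\<lambda>x. sparse_above p E (u x) (N x) (L x) (l x) (\<tau> x))"
proof -
  note r = assms[THEN rec_fun_comp, of "\<lambda>q. fst (fst q)"]
  show ?thesis
    unfolding sparse_above_def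
    by (intro Sig_1_ex Sig_conj Sig_1_of_0[OF Sig_0_prefix] Sig_1_of_0[OF Sig_0_eq]
        Sig_1_extends_outputs rec_intros r)
qed

text \<open>
  Forcing sparseness is a \<open>\<Pi>\<^sub>2\<close> property; in \<open>split_at\<close> it is what leads to the level \<open>3\<close>.
\<close>

lemma Sig_2_not_forces_sparse:
  assumes "rec_fun u" "rec_fun N" "rec_fun L" "rec_fun \<tau>"
  shows "Sig 2 (\<lambda>x. \<not> forces_sparse p E (u x) (N x) (L x) (\<tau> x))"
proof -
  note r = assms[THEN rec_fun_comp, of "\<lambda>q. fst (fst q)"]
  have "Sig 2 (\<lambda>x. \<exists>\<tau>' l. prefix (\<tau> x) \<tau>' \<and> L x \<le> l \<and> \<not> sparse_above p E (u x) (N x) (L x) l \<tau>')"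
    by (intro Sig_2_ex Sig_conj Sig_2_not Sig_1_sparse_above Sig_1_imp_2[OF Sig_1_of_0[OF Sig_0_prefix]]
        Sig_1_imp_2[OF Sig_1_of_0[OF Sig_0_le]] rec_intros r)
  then show ?thesis by (rule Sig_cong) (auto simp: forces_sparse_def)
qed

lemma sparse_imp_forced:
  assumes "generic 3 f" "sparse_from (outputs p E (graph f) u) N L"
  obtains j where "forces_sparse p E u N L (initial_segment f j)"
proof -
  let ?W = "\<lambda>\<tau>. \<exists>l. L \<le> l \<and> \<not> sparse_above p E u N L l \<tau>"
  have "Sig 3 ?W"
    by (intro Sig_2_imp_3 Sig_2_ex Sig_conj Sig_2_not Sig_1_sparse_above
        Sig_1_imp_2[OF Sig_1_of_0[OF Sig_0_le]] rec_intros)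
  moreover have "\<not> ?W (initial_segment f k)" for k
  proof -
    have "sparse_above p E u N L l (initial_segment f k)" if "L \<le> l" for l
    proof -
      obtain t where t: "length t = l" "extends (outputs p E (graph f) u) N (replicate L 1) t"
        using sparse_from_imp_extends[OF assms(2) \<open>L \<le> l\<close>] by blast
      from extends_outputs_initial_segment[OF t(2)] obtain n where
        "\<forall>m\<ge>n. extends (outputs p E (string_graph (initial_segment f m)) u) N (replicate L 1) t" by blast
      then have "extends (outputs p E (string_graph (initial_segment f (max n k))) u) N (replicate L 1) t"
        by simp
      moreover have "prefix (initial_segment f k) (initial_segment f (max n k))"
        by (rule prefix_initial_segment) simp
      ultimately show ?thesis using t(1) unfolding sparse_above_def by blast
    qed
    then show ?thesis by blast
  qed
  ultimately obtain j where "\<And>\<tau>. prefix (initial_segment f j) \<tau> \<Longrightarrow> \<not> ?W \<tau>"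
    using generic_avoid[OF assms(1), of ?W] by blast
  then show ?thesis using that[of j] unfolding forces_sparse_def by blast
qed

lemma extends_outputs_graph:
  "extends (outputs p E (string_graph (initial_segment f n)) u) N t t' \<Longrightarrow>
    extends (outputs p E (graph f) u) N t t'"
  by (erule extends_outputs_mono) (simp add: string_graph_initial_segment graph_def)

lemma forced_imp_sparse:
  assumes "generic 3 f" "forces_sparse p E u N L (initial_segment f j)"
  shows "sparse_from (outputs p E (graph f) u) N L"
proof (rule extends_imp_sparse_from)
  fix l assume l: "L \<le> l"
  let ?W = "\<lambda>\<tau>. \<exists>t. length t = l \<and> extends (outputs p E (string_graph \<tau>) u) N (replicate L 1) t"
  have S: "Sig 3 ?W"
    by (intro Sig_1_imp_3 Sig_1_ex Sig_conj Sig_1_of_0[OF Sig_0_eq] Sig_1_extends_outputs rec_intros)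
  have "\<exists>\<tau>. prefix (initial_segment f i) \<tau> \<and> ?W \<tau>" for i
  proof -
    have "prefix (initial_segment f j) (initial_segment f (max i j))"
      by (rule prefix_initial_segment) simp
    then have "sparse_above p E u N L l (initial_segment f (max i j))"
      using assms(2) l unfolding forces_sparse_def by blast
    then obtain \<tau> where \<tau>: "prefix (initial_segment f (max i j)) \<tau>" "?W \<tau>"
      unfolding sparse_above_def by blast
    have "prefix (initial_segment f i) (initial_segment f (max i j))"
      by (rule prefix_initial_segment) simp
    then have "prefix (initial_segment f i) \<tau>" using \<tau>(1) by (rule prefix_order.trans)
    with \<tau>(2) show ?thesis by blast
  qed
  from generic_meet[OF assms(1) S this] obtain k where "?W (initial_segment f k)" .
  then show "\<exists>t. length t = l \<and> extends (outputs p E (graph f) u) N (replicate L 1) t"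
    using extends_outputs_graph by blast
qed

section \<open>Two generic functions with a common description\<close>

text \<open>
  \<open>u'\<close> continues \<open>u\<close> by the values of \<open>\<tau>\<close> up to \<open>m\<close> and then by \<open>c\<close> blanks. This and the next notion are
  relations with bounded quantifiers instead of functions on strings, which makes their decidability
  immediate.
\<close>

definition blanked :: "nat list \<Rightarrow> nat list \<Rightarrow> nat \<Rightarrow> nat \<Rightarrow> nat list \<Rightarrow> bool" where
  "blanked u \<tau> m c u' \<longleftrightarrow> length u' = m + c \<and> prefix u u' \<and> (\<forall>z<m + c.
     (length u \<le> z \<and> z < m \<longrightarrow> entry u' z = Suc (entry \<tau> z)) \<and> (m \<le> z \<longrightarrow> entry u' z = 0))"

definition differ_on :: "nat \<Rightarrow> nat \<Rightarrow> nat list \<Rightarrow> nat list \<Rightarrow> bool" where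
  "differ_on m c \<tau> \<tau>' \<longleftrightarrow> length \<tau>' = length \<tau> \<and> m + c \<le> length \<tau> \<and> (\<forall>z<length \<tau>.
     (z < m \<longrightarrow> entry \<tau>' z = entry \<tau> z) \<and> (m + c \<le> z \<longrightarrow> entry \<tau>' z = entry \<tau> z) \<and>
     (m \<le> z \<and> z < m + c \<longrightarrow> entry \<tau>' z \<noteq> entry \<tau> z))"

lemma ex_blanked:
  assumes "length u \<le> m"
  obtains u' where "blanked u \<tau> m c u'"
proof -
  define u' where "u' = map (\<lambda>z. if z < length u then entry u z else if z < m then Suc (entry \<tau> z) else 0) [0..<m + c]"
  have "entry u' z = (if z < length u then entry u z else if z < m then Suc (entry \<tau> z) else 0)"
    if "z < m + c" for z
    using that unfolding u'_def entry_def[of "map _ _"] by simp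
  moreover have "length u' = m + c" by (simp add: u'_def)
  ultimately show ?thesis
    using assms by (intro that[of u']) (auto simp: blanked_def prefix_iff_entry)
qed

lemma blanked_cong:
  assumes "blanked u \<tau> m c u'" "\<And>z. z < m \<Longrightarrow> entry \<tau> z = entry \<tau>' z"
  shows "blanked u \<tau>' m c u'"
  using assms by (simp add: blanked_def)

text \<open>
  At lengths up to \<open>m\<close> only \<open>u\<close> contributes blanks. Beyond \<open>m\<close> there are at most \<open>2 * c\<close> of them, because
  \<open>u\<close> is no longer than the window, and the length is at least \<open>2 * E * c\<close>.
\<close>

lemma extends_blanked:
  assumes "blanked u \<tau> m c u'" "\<And>z. z < m \<Longrightarrow> entry \<tau> z = f z"
    and "length u \<le> c" "E * nbox u (length u) \<le> length u" "2 * E * c \<le> m"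
  shows "extends (graph f) E u u'"
proof (rule extendsI)
  show "prefix u u'" using assms(1) by (simp add: blanked_def)
  show "graph f z v" if "length u \<le> z" "z < length u'" "entry u' z = Suc v" for z v
    using that assms(1,2) by (cases "z < m") (auto simp: blanked_def graph_def)
  show "E * nbox u' l \<le> l" if l: "length u \<le> l" "l \<le> length u'" for l
  proof (cases "l \<le> m")
    case True
    have "nbox u' l \<le> nbox u (length u)"
      unfolding nbox_def
    proof (rule card_mono)
      show "{z. z < l \<and> entry u' z = 0} \<subseteq> {z. z < length u \<and> entry u z = 0}"
      proof (rule subsetI, clarify, intro conjI)
        fix z assume z: "z < l" "entry u' z = 0"
        with assms(1) True show "z < length u" by (auto simp: blanked_def intro: ccontr)
        with assms(1) z show "entry u z = 0" by (auto simp: blanked_def entry_prefix)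
      qed
    qed simp
    then have "E * nbox u' l \<le> E * nbox u (length u)" by simp
    with assms(4) l show ?thesis by linarith
  next
    case False
    have "nbox u' l \<le> card ({..<length u} \<union> {m..<m + c})"
      unfolding nbox_def
    proof (rule card_mono)
      show "{z. z < l \<and> entry u' z = 0} \<subseteq> {..<length u} \<union> {m..<m + c}"
        using assms(1) l(2) by (auto simp: blanked_def not_less intro: ccontr)
    qed simp
    also have "\<dots> \<le> card {..<length u} + card {m..<m + c}" by (rule card_Un_le)
    finally have "nbox u' l \<le> 2 * c" using assms(3) by simp
    then have "E * nbox u' l \<le> E * (2 * c)" by (rule mult_le_mono2)
    also have "E * (2 * c) = 2 * E * c" by simp
    also have "\<dots> \<le> m" by (rule assms(5))
    also have "\<dots> \<le> l" using False by simp
    finally show ?thesis .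
  qed
qed

lemma finite_binary_codes: "finite {t :: nat list. length t = L \<and> (\<forall>z<L. entry t z \<le> 2)}"
proof (rule finite_subset)
  show "{t :: nat list. length t = L \<and> (\<forall>z<L. entry t z \<le> 2)} \<subseteq> {t. set t \<subseteq> {..2} \<and> length t = L}"
    by (auto simp: entry_def in_set_conv_nth)
qed (rule finite_lists_length_eq, simp)

text \<open>
  The situation provided by \<open>NED_ge_uniform\<close>, for a function \<open>x\<close> with values in \<open>{0, 1}\<close>.
\<close>

locale uniform_reduction =
  fixes f x :: "nat \<Rightarrow> nat" and p :: prog and E :: nat and u0 :: "nat list"
  assumes generic: "generic 3 f"
    and u0: "E * nbox u0 (length u0) \<le> length u0"
    and uniform: "extends (graph f) E u0 u \<Longrightarrow>
      \<exists>k g. fits k (graph f) E u \<and> effective_dense_description x g \<and> computes p k g"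
    and binary: "x z \<le> 1"
begin

abbreviation out :: "(nat \<Rightarrow> nat \<Rightarrow> bool) \<Rightarrow> nat list \<Rightarrow> nat \<Rightarrow> nat \<Rightarrow> bool" where
  "out \<equiv> outputs p E"

text \<open>
  The string that yields the output is part of a description from which \<open>p\<close> computes a description
  of \<open>x\<close>, and there the value can only be the right one.
\<close>

lemma out_sound:
  assumes "extends (graph f) E u0 u" "out (graph f) u z v"
  shows "x z = v"
proof -
  obtain w where w: "extends (graph f) E u w" "ev p w z (Suc v)"
    using assms(2) by (auto simp: outputs_def)
  obtain k g where k: "fits k (graph f) E w" "effective_dense_description x g" "computes p k g"
    using uniform[OF extends_trans[OF assms(1) w(1)]] by blast
  have "initial_segment k (length w) = w"
    using fits_entry[OF k(1)] by (simp add: list_eq_iff_entry entry_initial_segment)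
  then have "code_box g z = Suc v"
    using w(2) k(3) unfolding computes_def by metis
  then have "g z = Some v" by (auto simp: code_box_def split: option.splits)
  with k(2) show ?thesis by (auto simp: effective_dense_description_def dest: spec[of _ z])
qed

text \<open>
  One description in the neighbourhood of \<open>u\<close> suffices: its initial segments produce all the values
  that \<open>p\<close> computes from it. This holds for every \<open>u\<close>, even if it blanks a window.
\<close>

lemma density_zero_undef_out:
  assumes "extends (graph f) E u0 u"
  shows "density_zero (undef (out (graph f) u))"
proof -
  obtain k g where k: "fits k (graph f) E u" "effective_dense_description x g" "computes p k g"
    using uniform[OF assms] by blast
  have sub: "undef (out (graph f) u) \<subseteq> {z. g z = None}"
  proof (rule subsetI, rule ccontr)
    fix z assume z: "z \<in> undef (out (graph f) u)" "z \<notin> {z. g z = None}"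
    then obtain v where "code_box g z = Suc v" by (auto simp: code_box_def)
    then obtain n where "ev p (initial_segment k n) z (Suc v)"
      using k(3) unfolding computes_def by blast
    then have "ev p (initial_segment k (max n (length u))) z (Suc v)"
      by (rule ev_initial_segment_mono) simp
    moreover have "extends (graph f) E u (initial_segment k (max n (length u)))"
      by (rule fits_extends[OF k(1)]) simp
    ultimately show False using z(1) by (auto simp: undef_def outputs_def)
  qed
  have "density_zero {z. g z = None}" using k(2) by (simp add: effective_dense_description_def)
  moreover have "N * card (undef (out (graph f) u) \<inter> {..<l}) \<le> N * card ({z. g z = None} \<inter> {..<l})" for N l
    by (rule mult_le_mono2, rule card_mono) (use sub in auto)
  ultimately show ?thesis unfolding density_zero_iff by (meson le_trans)
qed

text \<open>
  That outputs are binary is true for \<open>f\<close> and hence forced; the pigeonhole argument needs it for the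
  variants of \<open>f\<close>, whose outputs need not be values of \<open>x\<close>.
\<close>

lemma ex_out_binary:
  assumes "extends (graph f) E u0 u"
  obtains j where "\<And>\<tau> z v. prefix (initial_segment f j) \<tau> \<Longrightarrow> out (string_graph \<tau>) u z v \<Longrightarrow> v \<le> 1"
proof -
  let ?W = "\<lambda>\<tau>. \<exists>z v. 2 \<le> v \<and> out (string_graph \<tau>) u z v"
  have "Sig 3 ?W"
    by (intro Sig_1_imp_3 Sig_1_ex Sig_conj Sig_1_of_0[OF Sig_0_le] Sig_1_outputs rec_intros)
  moreover have "\<not> ?W (initial_segment f k)" for k
  proof
    assume "?W (initial_segment f k)"
    then obtain z v where "2 \<le> v" "out (string_graph (initial_segment f k)) u z v" by blast
    moreover from this(2) have "out (graph f) u z v"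
      by (rule outputs_mono) (simp add: string_graph_initial_segment graph_def)
    ultimately show False using out_sound[OF assms, of z v] binary[of z] by simp
  qed
  ultimately obtain j where j: "\<And>\<tau>. prefix (initial_segment f j) \<tau> \<Longrightarrow> \<not> ?W \<tau>"
    using generic_avoid[OF generic, of ?W] by blast
  have "v \<le> 1" if "prefix (initial_segment f j) \<tau>" "out (string_graph \<tau>) u z v" for \<tau> z v
    using j[OF that(1)] that(2) by (metis Suc_1 not_less_eq_eq)
  then show ?thesis by (rule that)
qed

text \<open>
  The window \<open>[m, m + c)\<close> with \<open>m = 2 * Suc E * c\<close>: short enough to be blanked within the bound \<open>1/E\<close>, by
  \<open>extends_blanked\<close>, and of a relative length that does not depend on \<open>c\<close>. The successor keeps \<open>m \<ge> c\<close>.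
\<close>

definition window :: "nat \<Rightarrow> nat set" where
  "window c = {2 * Suc E * c..<2 * Suc E * c + c}"

text \<open>
  The string \<open>\<tau>\<close> shows that the values on some window are irrelevant: a variant \<open>\<tau>'\<close> has other values
  there and admits the same string \<open>t\<close> of outputs up to \<open>L\<close>, and beyond \<open>L\<close> outputs that do not depend on
  the window are forced to be sufficiently dense.
\<close>

definition split_at :: "nat list \<Rightarrow> nat \<Rightarrow> nat \<Rightarrow> nat \<Rightarrow> nat list \<Rightarrow> bool" where
  "split_at u N K c0 \<tau> \<longleftrightarrow> (\<exists>c L \<tau>' t u'. c0 \<le> c \<and> K \<le> L \<and> differ_on (2 * Suc E * c) c \<tau> \<tau>' \<and>
     length t = L \<and> extends (out (string_graph \<tau>) u) N (replicate K 1) t \<and>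
     extends (out (string_graph \<tau>') u) N (replicate K 1) t \<and>
     blanked u \<tau> (2 * Suc E * c) c u' \<and> forces_sparse p E u' N L \<tau>)"

lemma Sig_3_split_at: "Sig 3 (split_at u N K c0)"
proof -
  have forces: "Sig 3 (\<lambda>y. forces_sparse p E (u' y) N (L y) (\<tau> y))"
    if "rec_fun u'" "rec_fun L" "rec_fun \<tau>" for u' :: "'a::coded \<Rightarrow> nat list" and L \<tau>
    by (intro Sig_3_not Sig_2_not_forces_sparse rec_intros that)
  have differ: "Sig 0 (\<lambda>y. differ_on (m y) (c y) (\<tau> y) (\<tau>' y))"
    if "rec_fun m" "rec_fun c" "rec_fun \<tau>" "rec_fun \<tau>'" for m c and \<tau> \<tau>' :: "'a::coded \<Rightarrow> nat list"
    unfolding differ_on_def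
    by (intro decidable_intros rec_intros that that[THEN rec_fun_comp, of fst])
  have blanked: "Sig 0 (\<lambda>y. blanked u (\<tau> y) (m y) (c y) (u' y))"
    if "rec_fun m" "rec_fun c" "rec_fun \<tau>" "rec_fun u'" for m c and \<tau> u' :: "'a::coded \<Rightarrow> nat list"
    unfolding blanked_def
    by (intro decidable_intros rec_intros that that[THEN rec_fun_comp, of fst])
  show ?thesis
    unfolding split_at_def[abs_def]
    by (intro Sig_3_ex Sig_conj forces Sig_0_imp_3[OF differ] Sig_0_imp_3[OF blanked]
        Sig_0_imp_3[OF Sig_0_eq] Sig_0_imp_3[OF Sig_0_le] Sig_1_imp_3[OF Sig_1_extends_outputs] rec_intros)
qed

text \<open>
  The window is placed beyond everything decided so far. The length \<open>L\<close> is taken from the true \<open>f\<close> with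
  the window blanked, and some initial segment of \<open>f\<close> forces that it is good; as the window is blank,
  its values can be replaced by any others without affecting this. With \<open>L\<close> fixed, one common
  continuation provides outputs up to \<open>L\<close> for as many constant values on the window as desired.
\<close>

lemma split_at_dense:
  assumes u: "extends (graph f) E u0 u" and K: "sparse_from (out (graph f) u) N K"
  shows "\<exists>\<tau>. prefix (initial_segment f j) \<tau> \<and> split_at u N K c0 \<tau>"
proof -
  obtain j1 where j1: "\<And>\<tau> z v. prefix (initial_segment f j1) \<tau> \<Longrightarrow> out (string_graph \<tau>) u z v \<Longrightarrow> v \<le> 1"
    using ex_out_binary[OF u] by blast
  obtain j2 where j2: "forces_sparse p E u N K (initial_segment f j2)"
    using sparse_imp_forced[OF generic K] by blast
  define c where "c = c0 + j + j1 + j2 + length u"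
  define m where "m = 2 * Suc E * c"
  have m: "c \<le> m" by (simp add: m_def)
  have u_box: "E * nbox u (length u) \<le> length u"
    using extends_nbox[OF u] extends_length[OF u] by blast
  obtain u' where u': "blanked u (initial_segment f m) m c u'"
    using ex_blanked[of u m] m by (auto simp: c_def)
  then have "extends (graph f) E u u'"
    by (rule extends_blanked) (use u_box in \<open>simp_all add: entry_initial_segment c_def m_def\<close>)
  from density_zero_sparse_from[OF density_zero_undef_out[OF extends_trans[OF u this]], of N]
  obtain L0 where L0: "\<And>L. L0 \<le> L \<Longrightarrow> sparse_from (out (graph f) u') N L" by blast
  define L where "L = max L0 K"
  obtain j3 where j3: "forces_sparse p E u' N L (initial_segment f j3)"
    using sparse_imp_forced[OF generic L0, of L] by (auto simp: L_def)
  define r0 where "r0 = map f [m + c..<max j3 (m + c)]"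
  \<comment> \<open>The strings that agree with \<open>f\<close> below \<open>m\<close>, have the constant value \<open>a\<close> on the window
     and continue with \<open>r\<close>.\<close>
  define S where "S a r = initial_segment f m @ replicate c a @ r" for a r
  have S_app: "S a (r @ r') = S a r @ r'" for a r r' by (simp add: S_def)
  have S_pre: "prefix (initial_segment f i) (S a r)" if "i \<le> m" for i a r
    using prefix_initial_segment[OF that, of f] by (auto simp: S_def prefix_def)
  have S_entry: "entry (S a r) z = (if z < m then f z else if z < m + c then a else entry r (z - (m + c)))" for a r z
    by (auto simp: S_def entry_def nth_append initial_segment_def)
  have S_length: "length (S a r) = m + c + length r" for a r by (simp add: S_def)
  have le: "j \<le> m" "j1 \<le> m" "j2 \<le> m" using m by (simp_all add: c_def)
  have common_tail: "\<exists>r. prefix r0 r \<and> (\<forall>a<A. \<exists>t. length t = L \<and>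
      extends (out (string_graph (S a r)) u) N (replicate K 1) t)" for A
  proof (induction A)
    case 0
    then show ?case by auto
  next
    case (Suc A)
    then obtain r where r: "prefix r0 r" "\<And>a. a < A \<Longrightarrow> \<exists>t. length t = L \<and>
      extends (out (string_graph (S a r)) u) N (replicate K 1) t" by blast
    have "sparse_above p E u N K L (S A r)"
      using j2 S_pre[OF le(3), of A r] unfolding forces_sparse_def by (simp add: L_def)
    then obtain r' t where t: "length t = L" "extends (out (string_graph (S A (r @ r'))) u) N (replicate K 1) t"
      unfolding sparse_above_def by (auto simp: S_app elim!: prefixE)
    have "\<exists>t. length t = L \<and> extends (out (string_graph (S a (r @ r'))) u) N (replicate K 1) t"
      if "a < Suc A" for a
    proof (cases "a = A")
      case True
      with t show ?thesis by blast
    next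
      case False
      with that r(2)[of a] obtain t where "length t = L"
        "extends (out (string_graph (S a r)) u) N (replicate K 1) t" by auto
      moreover have "prefix (S a r) (S a (r @ r'))" by (simp add: S_app)
      ultimately show ?thesis using extends_outputs_prefix by blast
    qed
    moreover have "prefix r0 (r @ r')" using r(1) by (simp add: prefix_prefix)
    ultimately show ?case by blast
  qed
  define B where "B = {t :: nat list. length t = L \<and> (\<forall>z<L. entry t z \<le> 2)}"
  obtain r where r: "prefix r0 r" "\<And>a. a < Suc (card B) \<Longrightarrow> \<exists>t. length t = L \<and>
      extends (out (string_graph (S a r)) u) N (replicate K 1) t"
    using common_tail[of "Suc (card B)"] by blast
  then obtain t where t: "\<And>a. a < Suc (card B) \<Longrightarrow> length (t a) = L"
      "\<And>a. a < Suc (card B) \<Longrightarrow> extends (out (string_graph (S a r)) u) N (replicate K 1) (t a)"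
    by metis
  have "t a \<in> B" if a: "a < Suc (card B)" for a
  proof -
    have "entry (t a) z \<le> 2" if "z < L" for z
    proof (cases "z < K")
      case True
      then show ?thesis
        using entry_prefix[OF extends_prefix[OF t(2)[OF a]], of z] by (simp add: entry_def)
    next
      case False
      then show ?thesis
        using extends_entry[OF t(2)[OF a], of z "entry (t a) z - 1"] j1[OF S_pre[OF le(2)], of a r z "entry (t a) z - 1"]
        by (cases "entry (t a) z") auto
    qed
    then show ?thesis using t(1)[OF a] by (simp add: B_def)
  qed
  then have "t ` {..<Suc (card B)} \<subseteq> B" by auto
  then have "card (t ` {..<Suc (card B)}) \<le> card B"
    using finite_binary_codes unfolding B_def by (rule card_mono[rotated])
  \<comment> \<open>Infinitely many values compete for finitely many strings of length \<open>L\<close>.\<close>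
  then have "\<not> inj_on t {..<Suc (card B)}" by (intro pigeonhole) simp
  then obtain a b where ab: "a < Suc (card B)" "b < Suc (card B)" "a \<noteq> b" "t a = t b"
    by (auto simp: inj_on_def)
  have "forces_sparse p E u' N L (S a r)"
    unfolding forces_sparse_def
  proof (intro allI impI)
    fix \<tau>' l assume "prefix (S a r) \<tau>'" "L \<le> l"
    then obtain r1 where r1: "\<tau>' = S a (r @ r1)" by (auto simp: S_app elim!: prefixE)
    let ?F = "\<lambda>r. initial_segment f (m + c) @ r"
    have "?F r0 = initial_segment f (max j3 (m + c))"
      by (simp add: r0_def initial_segment_def flip: map_append)
        (metis le_add_diff_inverse max.cobounded2 upt_add_eq_append zero_le)
    then have "prefix (initial_segment f j3) (?F r0)"
      by (simp add: prefix_initial_segment)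
    moreover have "prefix (?F r0) (?F (r @ r1))" using r(1) by (simp add: prefix_prefix)
    ultimately have "prefix (initial_segment f j3) (?F (r @ r1))" by (rule prefix_order.trans)
    then have "sparse_above p E u' N L l (?F (r @ r1))"
      using j3 \<open>L \<le> l\<close> unfolding forces_sparse_def by blast
    then obtain r2 t' where t': "length t' = l"
        "extends (out (string_graph (?F (r @ r1 @ r2))) u') N (replicate L 1) t'"
      unfolding sparse_above_def by (auto elim!: prefixE)
    \<comment> \<open>A string extending \<open>u'\<close> does not look at the window.\<close>
    have "length u' = m + c" using u' by (simp add: blanked_def)
    then have "extends (out (string_graph (S a (r @ r1 @ r2))) u') N (replicate L 1) t'"
      by (intro extends_outputs_mono[OF t'(2)])
        (auto simp: string_graph_def S_length S_entry, auto simp: entry_def nth_append)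
    moreover have "prefix \<tau>' (S a (r @ r1 @ r2))" unfolding r1 by (simp add: S_app)
    ultimately show "sparse_above p E u' N L l \<tau>'"
      using t'(1) unfolding sparse_above_def by blast
  qed
  moreover have "differ_on m c (S a r) (S b r)"
    using ab(3) by (simp add: differ_on_def S_length S_entry)
  moreover have "blanked u (S a r) m c u'"
    by (rule blanked_cong[OF u']) (simp add: S_entry entry_initial_segment)
  moreover have "c0 \<le> c" "K \<le> L" by (simp_all add: c_def L_def)
  ultimately have "split_at u N K c0 (S a r)"
    unfolding split_at_def m_def using t(1)[OF ab(1)] t(2)[OF ab(1)] t(2)[OF ab(2)] ab(4)
    by (intro exI[of _ c] exI[of _ L] exI[of _ "S b r"] exI[of _ "t a"] exI[of _ u']) auto
  with S_pre[OF le(1)] show ?thesis by blast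
qed

text \<open>
  The meaning of \<open>split_at\<close> for a generic \<open>f\<close>. Outputs above \<open>u'\<close> are produced with the window blank, so
  they are outputs for \<open>f'\<close> as well.
\<close>

lemma ex_split:
  assumes u: "extends (graph f) E u0 u" and K: "sparse_from (out (graph f) u) N K"
    and c0: "length u \<le> c0"
  obtains c f' t u' where "c0 \<le> c"
    "\<And>z. z < 2 * Suc E * c \<Longrightarrow> f' z = f z"
    "\<And>z. z \<in> window c \<Longrightarrow> f' z \<noteq> f z"
    "K \<le> length t"
    "extends (out (graph f) u) N (replicate K 1) t"
    "extends (out (graph f') u) N (replicate K 1) t"
    "extends (graph f) E u u'"
    "\<And>z v. out (graph f) u' z v \<Longrightarrow> out (graph f') u z v"
    "sparse_from (out (graph f) u') N (length t)"
proof -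
  obtain k where "split_at u N K c0 (initial_segment f k)"
    using generic_meet[OF generic Sig_3_split_at split_at_dense[OF u K]] by blast
  then obtain c L \<tau>' t u' where c: "c0 \<le> c" "K \<le> L" "length t = L"
    and d: "differ_on (2 * Suc E * c) c (initial_segment f k) \<tau>'"
    and t: "extends (out (string_graph (initial_segment f k)) u) N (replicate K 1) t"
      "extends (out (string_graph \<tau>') u) N (replicate K 1) t"
    and u': "blanked u (initial_segment f k) (2 * Suc E * c) c u'"
    and forced: "forces_sparse p E u' N L (initial_segment f k)"
    unfolding split_at_def by blast
  define m where "m = 2 * Suc E * c"
  note d = d[folded m_def] and u' = u'[folded m_def]
  define f' where "f' z = (if z < k then entry \<tau>' z else f z)" for z
  have k: "m + c \<le> k" using d by (simp add: differ_on_def)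
  have eq: "f' z = f z" if "z < m \<or> m + c \<le> z" for z
    using d that by (auto simp: f'_def differ_on_def entry_initial_segment)
  have neq: "f' z \<noteq> f z" if "m \<le> z" "z < m + c" for z
    using d that k by (auto simp: f'_def differ_on_def entry_initial_segment)
  have u_box: "E * nbox u (length u) \<le> length u"
    using extends_nbox[OF u] extends_length[OF u] by blast
  have ext: "extends (graph f) E u u'"
    by (rule extends_blanked[OF u'])
      (use u_box c0 c(1) k in \<open>simp_all add: entry_initial_segment m_def\<close>)
  have "extends (graph f') E u u'"
    by (rule extends_blanked[OF u'])
      (use u_box c0 c(1) k eq in \<open>simp_all add: entry_initial_segment m_def\<close>)
  then have out': "out (graph f') u z v" if "out (graph f) u' z v" for z v
  proof (rule outputs_extends[rotated])
    show "out (graph f') u' z v"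
      using that by (rule outputs_mono) (use u' eq in \<open>auto simp: graph_def blanked_def\<close>)
  qed
  have "extends (out (graph f') u) N (replicate K 1) t"
    using t(2) d by (elim extends_outputs_mono) (auto simp: string_graph_def graph_def f'_def differ_on_def)
  with c d t(1) ext out' eq neq forced_imp_sparse[OF generic forced] extends_outputs_graph[OF t(1)]
  show ?thesis by (intro that[of c f' t u']) (auto simp: m_def window_def)
qed

end

section \<open>A description of the set that computes no description of the function\<close>

lemma sparse_from_mono:
  assumes "sparse_from D N L" "N' \<le> N" "L \<le> L'"
  shows "sparse_from D N' L'"
  unfolding sparse_from_def
proof (intro allI impI)
  fix l assume "L' \<le> l"
  have "card (undef D \<inter> {L'..<l}) \<le> card (undef D \<inter> {L..<l})"
    by (rule card_mono) (use assms(3) in auto)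
  then have "N' * card (undef D \<inter> {L'..<l}) \<le> N * card (undef D \<inter> {L..<l})"
    using assms(2) by (intro mult_le_mono)
  also have "\<dots> \<le> l" using assms(1,3) \<open>L' \<le> l\<close> by (simp add: sparse_from_def)
  finally show "N' * card (undef D \<inter> {L'..<l}) \<le> l" .
qed

lemma mult_nbox_mono: "N * nbox t l \<le> (b::nat) \<Longrightarrow> N' \<le> N \<Longrightarrow> N' * nbox t l \<le> b"
  by (meson le_trans mult_le_mono1)

context uniform_reduction
begin

text \<open>
  The conditions of the final construction. The factor \<open>8\<close> pays for three halvings in \<open>defeat_next\<close>:
  one for replacing the part beyond \<open>t\<close> by the common string, one for continuing it with the window
  blanked, and one because an error of a program is looked for under the bound \<open>2 * N\<close>, so that it can
  still be continued under the bound \<open>N\<close>.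
\<close>

definition condition :: "nat list \<Rightarrow> nat \<Rightarrow> (nat \<Rightarrow> nat \<Rightarrow> bool) \<Rightarrow> bool" where
  "condition t N D \<longleftrightarrow> 8 * N * nbox t (length t) \<le> length t \<and> sparse_from D (8 * N) (length t) \<and>
     (\<exists>u. extends (graph f) E u0 u \<and> D = out (graph f) u)"

text \<open>
  In the second case no string in the neighbourhood gives an output on the window, so that the window
  stays blank for every description in it.
\<close>

definition defeats :: "prog \<Rightarrow> nat \<Rightarrow> nat list \<Rightarrow> nat \<Rightarrow> (nat \<Rightarrow> nat \<Rightarrow> bool) \<Rightarrow> bool" where
  "defeats q n t N D \<longleftrightarrow> (\<exists>z v. ev q t z (Suc v) \<and> f z \<noteq> v) \<or>
     (\<exists>c\<ge>n. \<forall>t' z v. extends D N t t' \<longrightarrow> z \<in> window c \<longrightarrow> \<not> ev q t' z (Suc v))"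

lemma grow_condition:
  assumes "2 * M * nbox t (length t) \<le> length t" "sparse_from D (2 * M) (length t)"
    and "extends (graph f) E u0 u" "D = out (graph f) u"
  obtains t' where "extends D M t t'" "i \<le> length t'" "condition t' N D"
proof -
  have "density_zero (undef D)" using density_zero_undef_out assms(3,4) by blast
  from grow_string[OF assms(1,2) this, of i "8 * N"] show ?thesis
    using assms(3,4) that unfolding condition_def by blast
qed

text \<open>
  If \<open>q\<close> can be led into an error, then this is done. Otherwise its correctness on the neighbourhood
  is forced by an initial segment of \<open>f\<close>, thus shared by the variant \<open>f'\<close> of \<open>f\<close> that \<open>ex_split\<close>
  provides. In the neighbourhood of the common string, with outputs restricted to those with the
  window blanked, all strings are admissible for \<open>f\<close> and for \<open>f'\<close>, so an output on the window would be
  the value of both.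
\<close>

lemma defeat_next:
  assumes "condition t N D"
  shows "\<exists>t' N' D'. condition t' N' D' \<and> extends D N t t' \<and> N \<le> N' \<and>
    (\<forall>z v. D' z v \<longrightarrow> D z v) \<and> defeats q n t' N' D'"
proof -
  obtain u where u: "extends (graph f) E u0 u" and D: "D = out (graph f) u"
    and box: "8 * N * nbox t (length t) \<le> length t" and sparse: "sparse_from D (8 * N) (length t)"
    using assms unfolding condition_def by blast
  show ?thesis
  proof (cases "\<exists>s z v. extends D (2 * N) t s \<and> ev q s z (Suc v) \<and> f z \<noteq> v")
    case True
    then obtain s z v where s: "extends D (2 * N) t s" "ev q s z (Suc v)" "f z \<noteq> v" by blast
    have len: "length t \<le> length s" using s(1) by (rule extends_length)
    have "2 * N * nbox s (length s) \<le> length s" using extends_nbox[OF s(1) len] by simp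
    moreover have "sparse_from D (2 * N) (length s)"
      using sparse len by (elim sparse_from_mono) simp_all
    ultimately obtain t' where t': "extends D N s t'" "condition t' N D"
      using grow_condition[OF _ _ u D] by blast
    have "extends D N t t'"
      using extends_trans[OF extends_mono[OF s(1)] t'(1)] by simp
    moreover have "ev q t' z (Suc v)"
      using ev_mono[OF extends_prefix[OF t'(1)] s(2)] .
    ultimately show ?thesis
      using t'(2) s(3) unfolding defeats_def by blast
  next
    case no_error: False
    let ?W = "\<lambda>\<tau>. \<exists>s z v. extends (out (string_graph \<tau>) u) (2 * N) t s \<and> z < length \<tau> \<and>
      ev q s z (Suc v) \<and> \<not> entry \<tau> z = v"
    have "Sig 3 ?W"
      by (intro Sig_1_imp_3 Sig_1_ex Sig_conj Sig_1_extends_outputs Sig_1_ev Sig_1_of_0[OF Sig_0_less]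
          Sig_1_of_0[OF Sig_0_not[OF Sig_0_eq]] rec_intros)
    moreover have "\<not> ?W (initial_segment f k)" for k
    proof
      assume "?W (initial_segment f k)"
      then obtain s z v where "extends (out (string_graph (initial_segment f k)) u) (2 * N) t s"
          "ev q s z (Suc v)" "f z \<noteq> v"
        by (auto simp: entry_initial_segment)
      with extends_outputs_graph no_error show False unfolding D by blast
    qed
    ultimately obtain j where j: "\<And>\<tau>. prefix (initial_segment f j) \<tau> \<Longrightarrow> \<not> ?W \<tau>"
      using generic_avoid[OF generic, of ?W] by blast
    define c0 where "c0 = n + j + length u"
    have "length u \<le> c0" by (simp add: c0_def)
    then obtain c f' s u' where c: "c0 \<le> c"
      and f': "\<And>z. z < 2 * Suc E * c \<Longrightarrow> f' z = f z" "\<And>z. z \<in> window c \<Longrightarrow> f' z \<noteq> f z"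
      and s: "length t \<le> length s" "extends (out (graph f) u) (8 * N) (replicate (length t) 1) s"
        "extends (out (graph f') u) (8 * N) (replicate (length t) 1) s"
      and u': "extends (graph f) E u u'" "\<And>z v. out (graph f) u' z v \<Longrightarrow> out (graph f') u z v"
        "sparse_from (out (graph f) u') (8 * N) (length s)"
      by (rule ex_split[OF u sparse[unfolded D]]) (rule that)
    define t1 where "t1 = t @ drop (length t) s"
    have t1: "extends D (4 * N) t t1" "extends (out (graph f') u) (4 * N) t t1"
      unfolding t1_def D using s(2,3) box by (auto intro!: extends_combine)
    have len: "length t1 = length s" using s(1) by (simp add: t1_def)
    let ?D' = "out (graph f) u'"
    have D': "?D' z v \<Longrightarrow> D z v" for z v
      using u'(1) outputs_extends unfolding D by blast
    have "2 * (2 * N) * nbox t1 (length t1) \<le> length t1"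
      using extends_nbox[OF t1(1) _ order_refl] s(1) len by simp
    moreover have "sparse_from ?D' (2 * (2 * N)) (length t1)"
      unfolding len using u'(3) by (elim sparse_from_mono) simp_all
    ultimately obtain t' where t': "extends ?D' (2 * N) t1 t'" "condition t' (2 * N) ?D'"
      using grow_condition[OF _ _ extends_trans[OF u u'(1)] refl] by blast
    have "\<not> ev q r z (Suc v)" if r: "extends ?D' (2 * N) t' r" and z: "z \<in> window c" for r z v
    proof
      assume ev: "ev q r z (Suc v)"
      have r1: "extends ?D' (2 * N) t1 r" using extends_trans[OF t'(1) r] .
      have "extends D (2 * N) t r"
        using extends_trans[OF extends_mono[OF t1(1)] extends_mono[OF r1]] D' by simp
      with no_error ev have "f z = v" by blast
      have "extends (out (graph f') u) (2 * N) t r"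
        using extends_trans[OF extends_mono[OF t1(2)] extends_mono[OF r1]] u'(2) by simp
      from extends_outputs_initial_segment[OF this] obtain n0 where
        n0: "\<And>m. n0 \<le> m \<Longrightarrow> extends (out (string_graph (initial_segment f' m)) u) (2 * N) t r" by blast
      define m where "m = n0 + Suc z + j"
      have "j \<le> c" using c by (simp add: c0_def)
      also have "c \<le> 2 * Suc E * c" by simp
      finally have "prefix (initial_segment f j) (initial_segment f' m)"
        using f'(1) by (auto simp: prefix_iff_entry entry_initial_segment m_def)
      from j[OF this] have "f' z = v"
        using n0[of m] ev by (auto simp: entry_initial_segment m_def)
      with \<open>f z = v\<close> f'(2)[OF z] show False by simp
    qed
    then have "defeats q n t' (2 * N) ?D'"
      unfolding defeats_def using c by (intro disjI2 exI[of _ c]) (auto simp: c0_def)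
    moreover have "extends D N t t'"
      using extends_trans[OF extends_mono[OF t1(1)] extends_mono[OF t'(1)], of D N] D' by simp
    ultimately show ?thesis
      using t'(2) D' by (intro exI[of _ t'] exI[of _ "2 * N"] exI[of _ ?D']) simp
  qed
qed

lemma not_NED_ge: "\<not> x \<ge>\<^sub>N\<^sub>E\<^sub>D f"
proof
  assume x: "x \<ge>\<^sub>N\<^sub>E\<^sub>D f"
  let ?D = "out (graph f) u0"
  \<comment> \<open>A program \<open>q\<close> is treated once for each bound \<open>n\<close>, which gives infinitely many windows.\<close>
  let ?Good = "\<lambda>i. defeats (from_nat (fst (prod_decode i))) (snd (prod_decode i))"
  have u0': "extends (graph f) E u0 u0" using u0 by (rule extends_refl)
  \<comment> \<open>The bound \<open>0\<close> puts no restriction on the number of blanks.\<close>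
  obtain t0 where t0: "extends ?D 0 [] t0" "condition t0 1 ?D"
    using grow_condition[of 0 "[]" ?D u0 0 1] u0' by (auto simp: sparse_from_def)
  obtain k where k: "fits k ?D 1 t0" "density_zero {z. k z = 0}"
    "\<And>i. \<exists>t N D. condition t N D \<and> ?Good i t N D \<and> fits k D N t"
  proof (rule generic_description[of condition t0 1 ?D ?Good])
    show "condition t0 1 ?D" by (rule t0(2))
  next
    fix t N D i
    assume "condition t N D"
    then show "\<exists>t' N' D'. condition t' N' D' \<and> extends D N t t' \<and> N \<le> N' \<and>
        (\<forall>z v. D' z v \<longrightarrow> D z v) \<and> ?Good i t' N' D'"
      by (rule defeat_next)
  next
    fix t N D i
    assume "condition t N D"
    then obtain u where u: "extends (graph f) E u0 u" "D = out (graph f) u"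
        "8 * N * nbox t (length t) \<le> length t" "sparse_from D (8 * N) (length t)"
      unfolding condition_def by blast
    have "2 * N * nbox t (length t) \<le> length t"
      using u(3) by (rule mult_nbox_mono) simp
    moreover have "sparse_from D (2 * N) (length t)"
      using u(4) by (rule sparse_from_mono) simp_all
    ultimately obtain t' where "extends D N t t'" "i \<le> length t'" "condition t' (N + i) D"
      using grow_condition[OF _ _ u(1,2)] by blast
    then show "\<exists>t' N'. condition t' N' D \<and> extends D N t t' \<and> N \<le> N' \<and> i \<le> N' \<and> i \<le> length t'"
      by (intro exI[of _ t'] exI[of _ "N + i"]) simp
  qed blast
  have "fits k ?D 0 []" using fits_trans[OF t0(1) k(1)] by simp
  then have val: "x z = v" if "k z = Suc v" for z v
    using fits_value[of k ?D 0 "[]" z v] out_sound[OF u0'] that by simp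
  obtain q g where g: "effective_dense_description f g" "computes q k g"
    by (rule NED_ge_computes[OF x k(2) val])
  have g_val: "f z = v" if "g z = Some v" for z v
    using g(1) that unfolding effective_dense_description_def by (metis option.distinct(1) option.inject)
  have blank: "\<exists>c\<ge>n. window c \<subseteq> {z. g z = None}" for n
  proof -
    obtain t N D where t: "defeats q n t N D" "fits k D N t"
      using k(3)[of "prod_encode (to_nat q, n)"] by auto
    have "initial_segment k (length t) = t"
      using fits_entry[OF t(2)] by (simp add: list_eq_iff_entry entry_initial_segment)
    then have "f z = v" if "ev q t z (Suc v)" for z v
    proof -
      have "code_box g z = Suc v"
        using that g(2) \<open>initial_segment k (length t) = t\<close> unfolding computes_def by metis
      then show ?thesis using g_val by (auto simp: code_box_def split: option.splits)
    qed
    with t(1) obtain c where c: "c \<ge> n" and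
      no: "\<And>t' z v. extends D N t t' \<Longrightarrow> z \<in> window c \<Longrightarrow> \<not> ev q t' z (Suc v)"
      unfolding defeats_def by blast
    have "g z = None" if z: "z \<in> window c" for z
    proof (rule ccontr)
      assume "g z \<noteq> None"
      then obtain v where "code_box g z = Suc v" by (auto simp: code_box_def)
      then obtain m where "ev q (initial_segment k m) z (Suc v)"
        using g(2) unfolding computes_def by blast
      then have "ev q (initial_segment k (max m (length t))) z (Suc v)"
        by (rule ev_initial_segment_mono) simp
      with no[OF fits_extends[OF t(2)] z] show False by simp
    qed
    with c show ?thesis by blast
  qed
  \<comment> \<open>A window is more than a fraction \<open>1 / (2 * Suc E + 2)\<close> of the numbers up to its end.\<close>
  have "density_zero {z. g z = None}" using g(1) by (simp add: effective_dense_description_def)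
  then obtain L where L: "\<And>l. l \<ge> L \<Longrightarrow> (2 * Suc E + 2) * card ({z. g z = None} \<inter> {..<l}) \<le> l"
    unfolding density_zero_iff by blast
  obtain c where c: "c \<ge> Suc L" "window c \<subseteq> {z. g z = None}" using blank by blast
  let ?l = "2 * Suc E * c + c"
  have "card (window c) \<le> card ({z. g z = None} \<inter> {..<?l})"
    by (rule card_mono) (use c(2) in \<open>auto simp: window_def\<close>)
  then have "(2 * Suc E + 2) * c \<le> (2 * Suc E + 2) * card ({z. g z = None} \<inter> {..<?l})"
    unfolding window_def card_atLeastLessThan by (intro mult_le_mono2) simp
  also have "\<dots> \<le> ?l" by (rule L) (use c(1) in simp)
  finally show False using c(1) by (simp add: algebra_simps)
qed

end

theorem theorem2:
  fixes f :: "nat \<Rightarrow> nat"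
  assumes "generic 3 f"
  shows "\<not> (\<exists>X :: nat set. f \<equiv>\<^sub>N\<^sub>E\<^sub>D (indicator X :: nat \<Rightarrow> nat))"
proof
  assume "\<exists>X :: nat set. f \<equiv>\<^sub>N\<^sub>E\<^sub>D (indicator X :: nat \<Rightarrow> nat)"
  then obtain X :: "nat set" where
    X: "f \<ge>\<^sub>N\<^sub>E\<^sub>D (indicator X :: nat \<Rightarrow> nat)" "(indicator X :: nat \<Rightarrow> nat) \<ge>\<^sub>N\<^sub>E\<^sub>D f"
    unfolding NED_equiv_def by blast
  obtain p u0 E where "E * nbox u0 (length u0) \<le> length u0"
    "\<And>u. extends (graph f) E u0 u \<Longrightarrow> \<exists>k g. fits k (graph f) E u \<and>
      effective_dense_description (indicator X) g \<and> computes p k g"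
    using NED_ge_uniform[OF X(1)] by blast
  with assms have "uniform_reduction f (indicator X) p E u0"
    by unfold_locales (auto simp: indicator_def)
  then show False using uniform_reduction.not_NED_ge X(2) by blast
qed

end
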